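(* Let $w\in S_n$, let $D\in\mathrm{RPD}(w)$, and suppose that $(i,j)$ is movable in $D$. Then $\mathcal{M}_{ij}(D)$ is the unique minimal element (with respect to $\le$) of the set $V_{ij}(D)$ of all $Q\in\mathrm{RPD}(w)$ such that $Q(i,j)=\bullet$ and $Q=\mathcal{L}_{p_mq_m}\circ\mathcal{L}_{p_{m-1}q_{m-1}}\circ\cdots\circ\mathcal{L}_{p_1q_1}(D)$ for some sequence of generalized ladder moves at positions $(p_1,q_1),\dots,(p_m,q_m)$ all (weakly) northeast of $(i,j)$, i.e. with $p_\ell\le i$ and $q_\ell\ge j$ for all $\ell$.
   Context: A pipe dream is a finite subset $D\subset \mathbb{Z}_{>0}\times\mathbb{Z}_{>0}$, in matrix coordinates ($(i,j)$ is row $i$ from the top, column $j$ from the left). Place a cross tile at each $(i,j)\in D$ (one strand joins the left and right edges, the other joins the top and bottom edges) and a bump tile at each $(i,j)\notin D$ (one strand joins the top edge to the left edge, the other joins the right edge to the bottom edge). Write $D(i,j)=+$ if $(i,j)\in D$ and $D(i,j)=\bullet$ otherwise. The strands form pipes going from the top boundary to the left boundary; pipe $x$ is the one entering at the top of column $x$. The permutation $w$ of $D$ is defined by: $w(i)$ is the label of the pipe that exits the left boundary in row $i$. Permutations $w\in S_n$ are regarded as permutations of $\mathbb{Z}_{>0}$ fixing all $m>n$. $\mathrm{RPD}(w)$ is the set of reduced pipe dreams for $w$: pipe dreams $D$ whose permutation is $w$ and such that $|D|$ equals the number of inversions of $w$. Generalized ladder move: let $D\in\mathrm{RPD}(w)$,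 and suppose there are $h<i$ and $j<k$ such that $D(i,j)=+$, $D(h,j)=D(i,k)=D(h,k)=\bullet$, and every other tile in $[h,i]\times[j,k]$ is a $+$. Then $(i,j)$ is called ladder movable in $D$, and $\mathcal{L}_{ij}(D)\in\mathrm{RPD}(w)$ is obtained from $D$ by swapping the tiles at $(i,j)$ and $(h,k)$ (given $(i,j)$, the pair $(h,k)$ is unique). Order: $D\le D'$ in $\mathrm{RPD}(w)$ iff $D'$ can be obtained from $D$ by a (possibly empty) sequence of generalized ladder moves. Move operators: a cross tile $(i,j)$ of $D$ is movable in $D$ if $D(h,j)=\bullet$ for some $h\in[1,i-1]$. Then put $h_{ij}(D)=\max\{h\in[1,i-1]: D(h,j)=\bullet\}$, $k_{ij}(D)=\min\{k\in[j+1,n]: D(i,k)=\bullet\}$ (which exists), $\mathrm{Rect}_{ij}(D)=[h,i]\times[j,k]$ with $h=h_{ij}(D)$, $k=k_{ij}(D)$, let $a$ be the largest $p\in[h,i)$ such that row $p$ contains a $\bullet$ in $\mathrm{Rect}_{ij}(D)$, and let $b$ be the smallest $q\in(j,k]$ such that column $q$ contains a $\bullet$ in $\mathrm{Rect}_{ij}(D)$. Define $\mathcal{M}_{ij}(D)$ recursively for $(i,j)$ movable in $D$: (i) if $a=h$ and $b=k$, then $(i,j)$ is ladder movable and $\mathcal{M}_{ij}(D)=\mathcal{L}_{ij}(D)$; (ii) if $a>h$, $\mathcal{M}_{ij}(D)=\mathcal{M}_{ij}(\mathcal{M}_{aj}(D))$; (iii) otherwise, $\mathcal{M}_{ij}(D)=\mathcal{M}_{ij}(\mathcal{M}_{ib}(D))$.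 This recursion is well defined and terminates. *)

theory Defs
  imports Main "HOL-Combinatorics.Permutations"
begin

text \<open>
  A pipe dream is the finite set of positions of its cross tiles, in matrix coordinates
  starting at 1; every other position with positive coordinates carries a bump tile.
\<close>

definition pipe_dream :: "(nat \<times> nat) set \<Rightarrow> bool" where
  "pipe_dream D \<longleftrightarrow> finite D \<and> D \<subseteq> {1..} \<times> {1..}"

text \<open>
  \<open>enters_top D x i j\<close> and \<open>enters_right D x i j\<close> say that pipe \<open>x\<close> (the one starting at the top
  of column \<open>x\<close>) enters tile \<open>(i, j)\<close> through its top, respectively right, edge.
  The left boundary in row \<open>i\<close> is the right edge of the fictitious tile \<open>(i, 0)\<close>,
  at which a pipe stops.
\<close>

inductive enters_top :: "(nat \<times> nat) set \<Rightarrow> nat \<Rightarrow> nat \<Rightarrow> nat \<Rightarrow> bool"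
  and enters_right :: "(nat \<times> nat) set \<Rightarrow> nat \<Rightarrow> nat \<Rightarrow> nat \<Rightarrow> bool"
  for D :: "(nat \<times> nat) set" and x :: nat
where
  start: "1 \<le> x \<Longrightarrow> enters_top D x 1 x"
| top_cross: "enters_top D x i j \<Longrightarrow> (i, j) \<in> D \<Longrightarrow> enters_top D x (i + 1) j"
| top_bump: "enters_top D x i j \<Longrightarrow> (i, j) \<notin> D \<Longrightarrow> enters_right D x i (j - 1)"
| right_cross: "enters_right D x i j \<Longrightarrow> 1 \<le> j \<Longrightarrow> (i, j) \<in> D \<Longrightarrow> enters_right D x i (j - 1)"
| right_bump: "enters_right D x i j \<Longrightarrow> 1 \<le> j \<Longrightarrow> (i, j) \<notin> D \<Longrightarrow> enters_top D x (i + 1) j"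

definition exits_in_row :: "(nat \<times> nat) set \<Rightarrow> nat \<Rightarrow> nat \<Rightarrow> bool" where
  "exits_in_row D x i \<longleftrightarrow> enters_right D x i 0"

text \<open>
  Permutations are functions on \<open>nat\<close>; only their values at positive arguments are
  determined by a pipe dream, and a permutation of \<open>{1..n}\<close> fixes \<open>0\<close>.
\<close>

definition has_perm :: "(nat \<times> nat) set \<Rightarrow> (nat \<Rightarrow> nat) \<Rightarrow> bool" where
  "has_perm D w \<longleftrightarrow> (\<forall>i\<ge>1. \<forall>x. exits_in_row D x i \<longleftrightarrow> x = w i)"

definition perm_inversions :: "(nat \<Rightarrow> nat) \<Rightarrow> (nat \<times> nat) set" where
  "perm_inversions w = {(a, b). 1 \<le> a \<and> a < b \<and> w b < w a}"

definition RPD :: "(nat \<Rightarrow> nat) \<Rightarrow> (nat \<times> nat) set set" where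
  "RPD w = {D. pipe_dream D \<and> has_perm D w \<and> card D = card (perm_inversions w)}"

definition ladder_rect :: "(nat \<times> nat) set \<Rightarrow> nat \<Rightarrow> nat \<Rightarrow> nat \<Rightarrow> nat \<Rightarrow> bool" where
  "ladder_rect D i j h k \<longleftrightarrow>
     1 \<le> h \<and> h < i \<and> 1 \<le> j \<and> j < k \<and>
     (i, j) \<in> D \<and> (h, j) \<notin> D \<and> (i, k) \<notin> D \<and> (h, k) \<notin> D \<and>
     (\<forall>p\<in>{h..i}. \<forall>q\<in>{j..k}. (p, q) \<notin> {(h, j), (i, k), (h, k)} \<longrightarrow> (p, q) \<in> D)"

definition ladder_movable :: "nat \<Rightarrow> nat \<Rightarrow> (nat \<times> nat) set \<Rightarrow> bool" where
  "ladder_movable i j D \<longleftrightarrow> (\<exists>h k. ladder_rect D i j h k)"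

lemma ladder_rect_unique:
  assumes "ladder_rect D i j h k" "ladder_rect D i j h' k'"
  shows "h = h'" "k = k'"
proof -
  have h: "\<not> h < h'"
    if r: "ladder_rect D i j h k" "ladder_rect D i j h' k'" for h k h' k'
  proof
    assume "h < h'"
    have "h' < i" "j < k" "(h', j) \<notin> D"
      using r unfolding ladder_rect_def by blast+
    have "\<forall>p\<in>{h..i}. \<forall>q\<in>{j..k}. (p, q) \<notin> {(h, j), (i, k), (h, k)} \<longrightarrow> (p, q) \<in> D"
      using r(1) unfolding ladder_rect_def by (elim conjE) assumption
    from this[rule_format, of h' j] show False
      using \<open>h < h'\<close> \<open>h' < i\<close> \<open>j < k\<close> \<open>(h', j) \<notin> D\<close> by simp
  qed
  have k: "\<not> k < k'"
    if r: "ladder_rect D i j h k" "ladder_rect D i j h' k'" for h k h' k'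
  proof
    assume "k < k'"
    have "h' < i" "j < k" "(i, k) \<notin> D"
      using r unfolding ladder_rect_def by blast+
    have "\<forall>p\<in>{h'..i}. \<forall>q\<in>{j..k'}. (p, q) \<notin> {(h', j), (i, k'), (h', k')} \<longrightarrow> (p, q) \<in> D"
      using r(2) unfolding ladder_rect_def by (elim conjE) assumption
    from this[rule_format, of i k] show False
      using \<open>k < k'\<close> \<open>h' < i\<close> \<open>j < k\<close> \<open>(i, k) \<notin> D\<close> by simp
  qed
  show "h = h'" using h[OF assms] h[OF assms(2,1)] by simp
  show "k = k'" using k[OF assms] k[OF assms(2,1)] by simp
qed

definition ladder_move :: "nat \<Rightarrow> nat \<Rightarrow> (nat \<times> nat) set \<Rightarrow> (nat \<times> nat) set" where
  "ladder_move i j D =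
     (let (h, k) = (THE (h, k). ladder_rect D i j h k) in insert (h, k) (D - {(i, j)}))"

lemma ladder_move_eq:
  assumes "ladder_rect D i j h k"
  shows "ladder_move i j D = insert (h, k) (D - {(i, j)})"
proof -
  have "(THE (h, k). ladder_rect D i j h k) = (h, k)"
  proof (rule the_equality)
    show "case (h, k) of (h, k) \<Rightarrow> ladder_rect D i j h k" using assms by simp
  next
    fix x assume "case x of (h, k) \<Rightarrow> ladder_rect D i j h k"
    then show "x = (h, k)"
      by (cases x) (use ladder_rect_unique[OF _ assms] in blast)
  qed
  then show ?thesis by (simp add: ladder_move_def)
qed

definition ladder_step :: "(nat \<times> nat) set \<Rightarrow> (nat \<times> nat) set \<Rightarrow> bool" where
  "ladder_step D D' \<longleftrightarrow> (\<exists>p q. ladder_movable p q D \<and> D' = ladder_move p q D)"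

definition RPD_le :: "(nat \<Rightarrow> nat) \<Rightarrow> (nat \<times> nat) set \<Rightarrow> (nat \<times> nat) set \<Rightarrow> bool" where
  "RPD_le w D D' \<longleftrightarrow> D \<in> RPD w \<and> D' \<in> RPD w \<and> ladder_step\<^sup>*\<^sup>* D D'"

definition RPD_minimal :: "(nat \<Rightarrow> nat) \<Rightarrow> (nat \<times> nat) set set \<Rightarrow> (nat \<times> nat) set \<Rightarrow> bool" where
  "RPD_minimal w V Q \<longleftrightarrow> Q \<in> V \<and> (\<forall>Q'\<in>V. RPD_le w Q' Q \<longrightarrow> Q' = Q)"

definition movable :: "nat \<Rightarrow> nat \<Rightarrow> (nat \<times> nat) set \<Rightarrow> bool" where
  "movable i j D \<longleftrightarrow> (i, j) \<in> D \<and> (\<exists>h\<in>{1..<i}. (h, j) \<notin> D)"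

definition rect_h :: "nat \<Rightarrow> nat \<Rightarrow> (nat \<times> nat) set \<Rightarrow> nat" where
  "rect_h i j D = Max {h \<in> {1..<i}. (h, j) \<notin> D}"

definition rect_k :: "nat \<Rightarrow> nat \<Rightarrow> nat \<Rightarrow> (nat \<times> nat) set \<Rightarrow> nat" where
  "rect_k n i j D = Min {k \<in> {j+1..n}. (i, k) \<notin> D}"

definition rect_a :: "nat \<Rightarrow> nat \<Rightarrow> nat \<Rightarrow> (nat \<times> nat) set \<Rightarrow> nat" where
  "rect_a n i j D =
     Max {p \<in> {rect_h i j D..<i}. \<exists>q\<in>{j..rect_k n i j D}. (p, q) \<notin> D}"

definition rect_b :: "nat \<Rightarrow> nat \<Rightarrow> nat \<Rightarrow> (nat \<times> nat) set \<Rightarrow> nat" where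
  "rect_b n i j D =
     Min {q \<in> {j<..rect_k n i j D}. \<exists>p\<in>{rect_h i j D..i}. (p, q) \<notin> D}"

text \<open>
  The recursion is nested and only known to terminate on reduced pipe dreams of permutations
  in \<open>S\<^sub>n\<close>, so it is defined as a partial function: its equation holds on the domain predicate
  \<open>move_op_dom\<close>, and nothing is specified outside of it or for positions that are not movable.
\<close>

function (domintros) move_op :: "nat \<Rightarrow> nat \<Rightarrow> nat \<Rightarrow> (nat \<times> nat) set \<Rightarrow> (nat \<times> nat) set" where
  "move_op n i j D =
     (if \<not> movable i j D then undefined
      else if rect_a n i j D = rect_h i j D \<and> rect_b n i j D = rect_k n i j D
        then ladder_move i j D
      else if rect_a n i j D > rect_h i j D
        then move_op n i j (move_op n (rect_a n i j D) j D)
      else move_op n i j (move_op n i (rect_b n i j D) D))"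
  by pat_completeness auto

definition ladder_step_NE ::
    "nat \<Rightarrow> nat \<Rightarrow> (nat \<times> nat) set \<Rightarrow> (nat \<times> nat) set \<Rightarrow> bool" where
  "ladder_step_NE i j D D' \<longleftrightarrow>
     (\<exists>p q. p \<le> i \<and> j \<le> q \<and> ladder_movable p q D \<and> D' = ladder_move p q D)"

definition V_set ::
    "(nat \<Rightarrow> nat) \<Rightarrow> nat \<Rightarrow> nat \<Rightarrow> (nat \<times> nat) set \<Rightarrow> (nat \<times> nat) set set" where
  "V_set w i j D = {Q \<in> RPD w. (i, j) \<notin> Q \<and> (ladder_step_NE i j)\<^sup>*\<^sup>* D Q}"

end

theory Submission
  imports Defs
begin

text \<open>
  On a frame whose interior rows carry no bump, the recursion amounts to one sweep, which moves the
  bumps of the top row to the bottom row; in general the lowest row with a bump is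
  emptied first, so that a move operator is a chain of such sweeps. If a ladder move weakly
  northeast of \<open>(i, j)\<close> turns \<open>D\<close> into \<open>D'\<close> and keeps the cross at \<open>(i, j)\<close>, then the move operator
  at \<open>(i, j)\<close> sends \<open>D\<close> below its value at \<open>D'\<close>: either the two moves commute, or they overlap in
  one of a few explicit configurations, where the two results differ by at most one ladder move.
  Following a path from \<open>D\<close> to any \<open>Q\<close> without a cross at \<open>(i, j)\<close>, the value of the move operator only
  increases until the step at \<open>(i, j)\<close>, where it equals the current pipe dream. Hence it lies below
  \<open>Q\<close>, i.e. it is the least element. Termination and antisymmetry come from the sum of the row
  indices of the crosses, which every ladder move decreases.
\<close>

subsection \<open>Permutations of pipe dreams\<close>

text \<open>
  Tiles are read row by row from top to bottom, each row from right to left. The tiles read before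
  \<open>(i, j)\<close> are separated from the others by a path crossing one edge per pipe; numbering these edges
  from the lower left, with the exits of the first \<open>i - 1\<close> rows coming first, the top edge of
  \<open>(i, j)\<close> is number \<open>i + j - 1\<close> and its right edge number \<open>i + j\<close>. So a cross at \<open>(i, j)\<close> swaps the
  pipes at these two places.
\<close>

definition before :: "nat \<times> nat \<Rightarrow> nat \<times> nat \<Rightarrow> bool" where
  "before x y \<longleftrightarrow> fst x < fst y \<or> fst x = fst y \<and> snd y < snd x"

definition tiles :: "nat \<Rightarrow> (nat \<times> nat) list" where
  "tiles N = List.product [1..<N] (rev [1..<N])"

text \<open>Later tiles are composed on the right, where they act on places; the value at a place is
  thus the label of the pipe there.\<close>

fun swaps :: "(nat \<times> nat) set \<Rightarrow> (nat \<times> nat) list \<Rightarrow> nat \<Rightarrow> nat" where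
  "swaps S [] = id"
| "swaps S (x # xs) =
     (if x \<in> S then transpose (fst x + snd x - 1) (fst x + snd x) \<circ> swaps S xs else swaps S xs)"

definition label_at :: "nat \<Rightarrow> (nat \<times> nat) set \<Rightarrow> nat \<Rightarrow> nat \<Rightarrow> nat \<Rightarrow> nat" where
  "label_at N S i j = swaps S (filter (\<lambda>x. before x (i, j)) (tiles N))"

lemma sorted_wrt_product:
  assumes "sorted_wrt (<) xs" "sorted_wrt (>) ys"
  shows "sorted_wrt before (List.product xs ys)"
  using assms(1)
proof (induction xs)
  case (Cons x xs)
  have "sorted_wrt before (map (Pair x) ys)"
    using assms(2) by (simp add: sorted_wrt_map before_def)
  moreover have "\<forall>u\<in>set (map (Pair x) ys). \<forall>v\<in>set (List.product xs ys). before u v"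
    using Cons.prems by (auto simp: before_def)
  ultimately show ?case using Cons by (simp add: sorted_wrt_append)
qed simp

lemma sorted_tiles: "sorted_wrt before (tiles N)"
  unfolding tiles_def by (rule sorted_wrt_product) (auto simp: sorted_wrt_rev)

lemma set_tiles: "set (tiles N) = {1..<N} \<times> {1..<N}"
  by (auto simp: tiles_def)

lemma distinct_tiles: "distinct (tiles N)"
  by (simp add: tiles_def distinct_product)

lemma swaps_append: "swaps S (xs @ ys) = swaps S xs \<circ> swaps S ys"
  by (induction xs) auto

lemma swaps_cong: "(\<And>x. x \<in> set xs \<Longrightarrow> x \<in> S \<longleftrightarrow> x \<in> S') \<Longrightarrow> swaps S xs = swaps S' xs"
  by (induction xs) auto

lemma swaps_disjoint: "S \<inter> set xs = {} \<Longrightarrow> swaps S xs = id"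
  by (induction xs) auto

lemma swaps_fixes:
  "(\<And>x. x \<in> S \<Longrightarrow> x \<in> set xs \<Longrightarrow> a \<noteq> fst x + snd x - 1 \<and> a \<noteq> fst x + snd x) \<Longrightarrow> swaps S xs a = a"
  by (induction xs) auto

lemma bij_swaps: "bij (swaps S xs)"
  by (induction xs) (simp_all add: bij_comp del: id_apply)

lemma swaps_single:
  assumes "distinct xs" "S \<inter> set xs = {x}"
  shows "swaps S xs = transpose (fst x + snd x - 1) (fst x + snd x)"
  using assms
proof (induction xs)
  case (Cons y xs)
  show ?case
  proof (cases "y = x")
    case True
    with Cons.prems have "S \<inter> set xs = {}" "x \<in> S" by auto
    with True show ?thesis by (simp add: swaps_disjoint)
  next
    case False
    have "y \<in> set (y # xs)" "set xs \<subseteq> set (y # xs)" by auto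
    with False Cons.prems(2) have y: "y \<notin> S" "S \<inter> set xs = {x}"
      using set_ConsD[of x y xs] by blast+
    have "distinct xs" using Cons.prems(1) by simp
    from Cons.IH[OF this y(2)] y(1) show ?thesis by simp
  qed
qed simp

text \<open>As \<open>P\<close> is downward closed for \<open>before\<close>, its elements form an
  initial segment of the sorted list.\<close>

lemma filter_sorted_append:
  assumes "sorted_wrt before xs" "\<And>x. P x \<Longrightarrow> Q x" "\<And>x y. before x y \<Longrightarrow> P y \<Longrightarrow> P x"
  shows "filter Q xs = filter P xs @ filter (\<lambda>x. \<not> P x \<and> Q x) xs"
  using assms(1)
proof (induction xs)
  case (Cons x xs)
  show ?case
  proof (cases "P x")
    case True
    with Cons assms(2) show ?thesis by simp
  next
    case False
    with Cons.prems assms(3) have "filter P xs = []" by (simp add: filter_empty_conv) blast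
    with False Cons show ?thesis by simp
  qed
qed simp

lemma before_trans: "before x y \<Longrightarrow> before y z \<Longrightarrow> before x z"
  by (auto simp: before_def)

lemma label_at_split:
  assumes "before (i, j) (i', j')"
  shows "label_at N S i' j' = label_at N S i j \<circ>
    swaps S (filter (\<lambda>x. \<not> before x (i, j) \<and> before x (i', j')) (tiles N))"
proof -
  have "filter (\<lambda>x. before x (i', j')) (tiles N) = filter (\<lambda>x. before x (i, j)) (tiles N) @
      filter (\<lambda>x. \<not> before x (i, j) \<and> before x (i', j')) (tiles N)"
    by (rule filter_sorted_append[OF sorted_tiles])
      (erule before_trans[OF _ assms] before_trans, assumption?)+
  then show ?thesis unfolding label_at_def by (simp only: swaps_append)
qed

section \<open>Tracing pipes against the product of transpositions\<close>

locale bounded_pipe_dream =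
  fixes D :: "(nat \<times> nat) set" and N :: nat
  assumes D_sub: "D \<subseteq> {1..<N} \<times> {1..<N}"
begin

text \<open>In reading order only the tile \<open>(i, j)\<close> separates the two positions;
  \<open>j - 1 = 0\<close> is the fictitious column at the left boundary.\<close>

lemma label_at_left:
  assumes "1 \<le> j"
  shows "label_at N D i (j - 1) = label_at N D i j \<circ> (if (i, j) \<in> D then transpose (i + j - 1) (i + j) else id)"
proof -
  let ?m = "filter (\<lambda>x. \<not> before x (i, j) \<and> before x (i, j - 1)) (tiles N)"
  have m: "set ?m = set (tiles N) \<inter> {(i, j)}"
    using assms by (auto simp: before_def)
  have "swaps D ?m = (if (i, j) \<in> D then transpose (i + j - 1) (i + j) else id)"
  proof (cases "(i, j) \<in> D")
    case True
    then have "D \<inter> set ?m = {(i, j)}" using D_sub unfolding m set_tiles by blast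
    from swaps_single[OF _ this] True show ?thesis by (simp add: distinct_tiles)
  next
    case False
    then have "D \<inter> set ?m = {}" unfolding m by blast
    with False show ?thesis by (simp add: swaps_disjoint)
  qed
  moreover have "before (i, j) (i, j - 1)" using assms by (simp add: before_def)
  ultimately show ?thesis using label_at_split[of i j i "j - 1" N D] by simp
qed

text \<open>The tiles read in between lie in row \<open>i\<close> left of column \<open>j\<close>,
  where they act on places below \<open>i + j\<close>, or in row \<open>i + 1\<close> right of
  column \<open>j\<close>, where they act on places above it.\<close>

lemma label_at_down:
  assumes "1 \<le> j"
  shows "label_at N D (i + 1) j (i + j) = label_at N D i (j - 1) (i + j)"
proof -
  have "before (i, j - 1) (i + 1, j)" by (simp add: before_def)
  from label_at_split[OF this] show ?thesis
    using assms by (auto simp: before_def intro!: arg_cong[where f = "label_at N D i (j - Suc 0)"] swaps_fixes)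
qed

lemma enters_label_at:
  "enters_top D x i j \<Longrightarrow> 1 \<le> i \<and> 1 \<le> j \<and> label_at N D i j (i + j - 1) = x"
  "enters_right D x i j \<Longrightarrow> 1 \<le> i \<and> label_at N D i j (i + j) = x"
proof (induction rule: enters_top_enters_right.inducts)
  case start
  have "label_at N D 1 x x = x" unfolding label_at_def
    by (rule swaps_fixes) (auto simp: before_def set_tiles)
  with start show ?case by simp
next
  case (top_cross i j)
  then show ?case using label_at_left[of j i] label_at_down[of j i] by simp
next
  case (top_bump i j)
  then show ?case using label_at_left[of j i] by simp
next
  case (right_cross i j)
  then show ?case using label_at_left[of j i] by simp
next
  case (right_bump i j)
  then show ?case using label_at_left[of j i] label_at_down[of j i] by simp
qed

text \<open>From column \<open>N\<close> on all tiles are bumps, which starts a descending induction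
  on the column.\<close>

lemma enters_right_exists:
  assumes "\<And>j. 1 \<le> j \<Longrightarrow> \<exists>x. enters_top D x i j"
  shows "\<exists>x. enters_right D x i j"
proof -
  have big: "\<exists>x. enters_right D x i j" if "N \<le> j + 1" for j
  proof -
    obtain x where "enters_top D x i (j + 1)" using assms[of "j + 1"] by auto
    moreover have "(i, j + 1) \<notin> D" using D_sub that by auto
    ultimately show ?thesis using top_bump[of D x i "j + 1"] by auto
  qed
  show ?thesis
  proof (cases "N \<le> j + 1")
    case False
    then have "j \<le> N" by simp
    then show ?thesis
    proof (induction rule: inc_induct)
      case base
      then show ?case using big by simp
    next
      case (step m)
      obtain x where x: "enters_right D x i (Suc m)" using step by blast
      obtain y where y: "enters_top D y i (Suc m)" using assms[of "Suc m"] by auto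
      show ?case
        using right_cross[OF x] top_bump[OF y] by (cases "(i, Suc m) \<in> D") auto
    qed
  qed (rule big)
qed

lemma enters_top_exists: "1 \<le> i \<Longrightarrow> 1 \<le> j \<Longrightarrow> \<exists>x. enters_top D x i j"
proof (induction i arbitrary: j rule: dec_induct)
  case base
  then show ?case using start by fastforce
next
  case (step i)
  obtain x where x: "enters_right D x i j" using enters_right_exists step.IH by blast
  obtain y where y: "enters_top D y i j" using step by blast
  show ?case
    using top_cross[OF y] right_bump[OF x] step.prems by (cases "(i, j) \<in> D") auto
qed

text \<open>The labels determine the only pipe that can exit in row \<open>i\<close>; the converse
  follows because some pipe does exit there.\<close>

lemma exits_iff:
  assumes "1 \<le> i"
  shows "exits_in_row D x i \<longleftrightarrow> x = swaps D (tiles N) i"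
proof -
  have *: "x = swaps D (tiles N) i" if "exits_in_row D x i" for x
  proof -
    have x: "label_at N D i 0 i = x"
      using enters_label_at(2)[of x i 0] that by (simp add: exits_in_row_def)
    let ?m = "filter (\<lambda>x. \<not> before x (i, 0)) (tiles N)"
    have "tiles N = filter (\<lambda>x. before x (i, 0)) (tiles N) @ ?m"
      using filter_sorted_append[OF sorted_tiles, of "\<lambda>x. before x (i, 0)" "\<lambda>_. True"]
        before_trans by auto
    then have "swaps D (tiles N) i = (label_at N D i 0 \<circ> swaps D ?m) i"
      unfolding label_at_def swaps_append[symmetric] by metis
    \<comment> \<open>The remaining tiles lie below row \<open>i\<close> and act only on places
      above \<open>i\<close>.\<close>
    also have "\<dots> = label_at N D i 0 i"
      by (auto simp: before_def set_tiles intro!: arg_cong[where f = "label_at N D i 0"] swaps_fixes)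
    finally show ?thesis using x by simp
  qed
  moreover obtain y where "exits_in_row D y i"
    using enters_right_exists enters_top_exists assms unfolding exits_in_row_def by blast
  ultimately show ?thesis by blast
qed

lemma has_perm_iff: "has_perm D w \<longleftrightarrow> (\<forall>i\<ge>1. w i = swaps D (tiles N) i)"
  using exits_iff unfolding has_perm_def by metis

end

lemma label_at_cong:
  assumes "\<And>x. before x (i, j) \<Longrightarrow> x \<in> S \<longleftrightarrow> x \<in> S'"
  shows "label_at N S i j = label_at N S' i j"
  unfolding label_at_def by (rule swaps_cong) (use assms in auto)

text \<open>A transposition inserted in the middle of the product moves to the front when conjugated
  by the prefix, and the prefix is \<open>label_at\<close>.\<close>

lemma swaps_insert:
  assumes "(i, j) \<in> set (tiles N)" "(i, j) \<notin> B"
  shows "swaps (insert (i, j) B) (tiles N) =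
    transpose (label_at N B i j (i + j - 1)) (label_at N B i j (i + j)) \<circ> swaps B (tiles N)"
proof -
  obtain xs ys where t: "tiles N = xs @ (i, j) # ys"
    using assms(1) by (meson split_list)
  have nd: "(i, j) \<notin> set xs" "(i, j) \<notin> set ys" using distinct_tiles[of N] t by auto
  have "filter (\<lambda>x. before x (i, j)) (tiles N) = xs"
    using sorted_tiles[of N] unfolding t
    by (auto simp: sorted_wrt_append before_def filter_empty_conv)
  then have label_at: "label_at N B i j = swaps B xs" by (simp add: label_at_def)
  have c: "swaps (insert (i, j) B) xs = swaps B xs" "swaps (insert (i, j) B) ys = swaps B ys"
    using nd by (auto intro: swaps_cong)
  have "swaps B xs \<circ> transpose a b = transpose (swaps B xs a) (swaps B xs b) \<circ> swaps B xs" for a b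
    using bij_swaps[of B xs] by (auto simp: fun_eq_iff transpose_def bij_def inj_eq)
  then show ?thesis using assms(2) c
    by (simp add: t swaps_append label_at o_assoc)
qed

text \<open>The two pipes that touch at the lower left corner of the rectangle are the ones that touch
  at its upper right corner, so a cross at either corner has the same effect on the permutation,
  and crosses at both corners cancel.\<close>
lemma swaps_rect:
  assumes "B \<subseteq> {1..<N} \<times> {1..<N}" "i < N" "k < N" "1 \<le> h" "h < i" "1 \<le> j" "j < k"
    and bumps: "(i, j) \<notin> B" "(h, j) \<notin> B" "(i, k) \<notin> B" "(h, k) \<notin> B"
    and cross: "\<And>p q. p \<in> {h..i} \<Longrightarrow> q \<in> {j..k} \<Longrightarrow>
      (p, q) \<notin> {(i, j), (h, j), (i, k), (h, k)} \<Longrightarrow> (p, q) \<in> B"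
  shows "swaps (insert (h, k) B) (tiles N) = swaps (insert (i, j) B) (tiles N)"
    and "swaps (insert (h, k) (insert (i, j) B)) (tiles N) = swaps B (tiles N)"
proof -
  interpret bounded_pipe_dream B N by standard fact
  \<comment> \<open>Pipe \<open>x\<close> turns left at \<open>(h, k)\<close>, follows row
    \<open>h\<close>, and descends column \<open>j\<close>; pipe \<open>y\<close> descends column
    \<open>k\<close>, turns at \<open>(i, k)\<close>, and follows row \<open>i\<close>. They meet
    again at \<open>(i, j)\<close>.\<close>
  obtain x where x: "enters_top B x h k" using enters_top_exists[of h k] assms by auto
  obtain y where y: "enters_right B y h k"
    using enters_right_exists[of h k] enters_top_exists[of h] assms by auto
  have "enters_right B x h q" if "j \<le> q" "q \<le> k - 1" for q
    using that(2,1)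
  proof (induction rule: inc_induct)
    case base
    then show ?case using top_bump[OF x] bumps by simp
  next
    case (step m)
    then have "(h, Suc m) \<in> B" using cross[of h "Suc m"] assms by auto
    from right_cross[OF _ _ this] step show ?case by simp
  qed
  from this[of j] have xj: "enters_right B x h j" using assms by simp
  have "enters_top B x p j" if "h + 1 \<le> p" "p \<le> i" for p
    using that
  proof (induction rule: dec_induct)
    case base
    then show ?case using right_bump[OF xj] bumps assms by simp
  next
    case (step m)
    then have "(m, j) \<in> B" using cross[of m j] assms by auto
    from top_cross[OF _ this] step show ?case by simp
  qed
  from this[of i] have xi: "enters_top B x i j" using assms by simp
  have "enters_top B y p k" if "h + 1 \<le> p" "p \<le> i" for p
    using that
  proof (induction rule: dec_induct)
    case base
    then show ?case using right_bump[OF y] bumps assms by simp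
  next
    case (step m)
    then have "(m, k) \<in> B" using cross[of m k] assms by auto
    from top_cross[OF _ this] step show ?case by simp
  qed
  from this[of i] have yk: "enters_top B y i k" using assms by simp
  have "enters_right B y i q" if "j \<le> q" "q \<le> k - 1" for q
    using that(2,1)
  proof (induction rule: inc_induct)
    case base
    then show ?case using top_bump[OF yk] bumps by simp
  next
    case (step m)
    then have "(i, Suc m) \<in> B" using cross[of i "Suc m"] assms by auto
    from right_cross[OF _ _ this] step show ?case by simp
  qed
  from this[of j] have yi: "enters_right B y i j" using assms by simp
  have l: "label_at N B h k (h + k - 1) = x" "label_at N B h k (h + k) = y"
    "label_at N B i j (i + j - 1) = x" "label_at N B i j (i + j) = y"
    using enters_label_at x y xi yi by auto
  have "swaps (insert (h, k) B) (tiles N) = transpose x y \<circ> swaps B (tiles N)"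
    using swaps_insert[of h k N B] assms l by (auto simp: set_tiles)
  moreover have i: "swaps (insert (i, j) B) (tiles N) = transpose x y \<circ> swaps B (tiles N)"
    using swaps_insert[of i j N B] assms l by (auto simp: set_tiles)
  ultimately show "swaps (insert (h, k) B) (tiles N) = swaps (insert (i, j) B) (tiles N)" by simp
  \<comment> \<open>As \<open>h < i\<close>, the tile \<open>(i, j)\<close> is read after
    \<open>(h, k)\<close> and does not affect the labels there, so both crosses contribute the same
    transposition.\<close>
  have "label_at N (insert (i, j) B) h k = label_at N B h k"
    by (rule label_at_cong) (use assms in \<open>auto simp: before_def\<close>)
  then have "swaps (insert (h, k) (insert (i, j) B)) (tiles N) =
      transpose x y \<circ> swaps (insert (i, j) B) (tiles N)"
    using swaps_insert[of h k N "insert (i, j) B"] assms l by (auto simp: set_tiles)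
  then show "swaps (insert (h, k) (insert (i, j) B)) (tiles N) = swaps B (tiles N)"
    using i by (auto simp: fun_eq_iff)
qed

section \<open>Inversions and reduced products\<close>

text \<open>Exchanging adjacent positions reverses the order of the pair \<open>(a, a + 1)\<close>
  only and permutes the other pairs.\<close>

lemma inversions_transpose_subset:
  fixes f :: "nat \<Rightarrow> nat"
  assumes "1 \<le> a"
  shows "perm_inversions (f \<circ> transpose a (a + 1)) \<subseteq>
    insert (a, a + 1) (map_prod (transpose a (a + 1)) (transpose a (a + 1)) ` perm_inversions f)"
proof
  let ?s = "transpose a (a + 1)"
  fix x assume x: "x \<in> perm_inversions (f \<circ> ?s)"
  obtain c d where cd: "x = (c, d)" by (cases x)
  have "(?s c, ?s d) \<in> perm_inversions f" if "x \<noteq> (a, a + 1)"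
    using x that assms unfolding cd perm_inversions_def by (auto simp: transpose_def)
  moreover have "x = map_prod ?s ?s (?s c, ?s d)" by (simp add: cd)
  ultimately show "x \<in> insert (a, a + 1) (map_prod ?s ?s ` perm_inversions f)" by blast
qed

lemma finite_inversions_transpose:
  assumes "1 \<le> a" "finite (perm_inversions f)"
  shows "finite (perm_inversions (f \<circ> transpose a (a + 1)))"
    and "card (perm_inversions (f \<circ> transpose a (a + 1))) \<le> card (perm_inversions f) + 1"
proof -
  let ?g = "map_prod (transpose a (a + 1)) (transpose a (a + 1))"
  have fin: "finite (insert (a, a + 1) (?g ` perm_inversions f))"
    using assms by simp
  show "finite (perm_inversions (f \<circ> transpose a (a + 1)))"
    using finite_subset[OF inversions_transpose_subset fin] assms by simp
  have "card (perm_inversions (f \<circ> transpose a (a + 1))) \<le> card (insert (a, a + 1) (?g ` perm_inversions f))"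
    using card_mono[OF fin inversions_transpose_subset] assms by simp
  also have "\<dots> \<le> card (?g ` perm_inversions f) + 1"
    by (simp add: card_insert_if assms)
  also have "\<dots> \<le> card (perm_inversions f) + 1"
    by (simp add: card_image_le assms)
  finally show "card (perm_inversions (f \<circ> transpose a (a + 1))) \<le> card (perm_inversions f) + 1" .
qed

text \<open>At an ascent \<open>(a, a + 1)\<close> becomes a new inversion and all old ones survive,
  so the inclusion \<open>inversions_transpose_subset\<close> is an equality.\<close>

lemma card_inversions_ascent:
  fixes f :: "nat \<Rightarrow> nat"
  assumes "1 \<le> a" "finite (perm_inversions f)" "f a < f (a + 1)"
  shows "card (perm_inversions (f \<circ> transpose a (a + 1))) = card (perm_inversions f) + 1"
proof -
  let ?s = "transpose a (a + 1)"
  have eq: "perm_inversions (f \<circ> ?s) = insert (a, a + 1) (map_prod ?s ?s ` perm_inversions f)"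
  proof (rule antisym)
    show "insert (a, a + 1) (map_prod ?s ?s ` perm_inversions f) \<subseteq> perm_inversions (f \<circ> ?s)"
      using assms(1,3) unfolding perm_inversions_def by (auto simp: transpose_def split: if_splits)
  qed (rule inversions_transpose_subset[OF assms(1)])
  have "(a, a + 1) \<notin> map_prod ?s ?s ` perm_inversions f"
  proof
    assume "(a, a + 1) \<in> map_prod ?s ?s ` perm_inversions f"
    then obtain c d where cd: "(c, d) \<in> perm_inversions f" "?s c = a" "?s d = a + 1" by auto
    then have "c = a + 1" "d = a" by (metis transpose_involutory transpose_apply_first transpose_apply_second)+
    with cd(1) show False by (simp add: perm_inversions_def)
  qed
  moreover have "inj (map_prod ?s ?s)" by (intro prod.inj_map inj_on_transpose)
  then have "card (map_prod ?s ?s ` perm_inversions f) = card (perm_inversions f)"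
    by (simp add: card_image inj_on_subset)
  ultimately show ?thesis unfolding eq using assms by simp
qed

lemma swaps_snoc:
  "swaps S (xs @ [x]) = (if x \<in> S then swaps S xs \<circ> transpose (fst x + snd x - 1) (fst x + snd x) else swaps S xs)"
  by (simp add: swaps_append)

text \<open>Each cross multiplies by one adjacent transposition, which adds at most one
  inversion.\<close>

lemma card_inversions_swaps:
  assumes "distinct xs" "\<And>x. x \<in> set xs \<Longrightarrow> 1 \<le> fst x \<and> 1 \<le> snd x"
  shows "finite (perm_inversions (swaps S xs)) \<and> card (perm_inversions (swaps S xs)) \<le> card (S \<inter> set xs)"
  using assms
proof (induction xs rule: rev_induct)
  case Nil
  have "perm_inversions id = {}" by (auto simp: perm_inversions_def)
  then show ?case by (simp add: id_def)
next
  case (snoc x xs)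
  have IH: "finite (perm_inversions (swaps S xs))" "card (perm_inversions (swaps S xs)) \<le> card (S \<inter> set xs)"
    using snoc by auto
  have "1 \<le> fst x" "1 \<le> snd x" using snoc.prems by auto
  then have a: "1 \<le> fst x + snd x - 1" "fst x + snd x - 1 + 1 = fst x + snd x" by linarith+
  show ?case
  proof (cases "x \<in> S")
    case True
    then have "card (S \<inter> set (xs @ [x])) = card (S \<inter> set xs) + 1"
      using snoc.prems by simp
    moreover have "swaps S (xs @ [x]) = swaps S xs \<circ> transpose (fst x + snd x - 1) (fst x + snd x - 1 + 1)"
      unfolding a(2) using True by (simp add: swaps_snoc)
    ultimately show ?thesis
      using IH finite_inversions_transpose[OF a(1) IH(1)] by (simp del: o_apply)
  qed (use IH in \<open>simp add: swaps_snoc\<close>)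
qed

text \<open>In a reduced product the last cross produces a descent at its place \<open>a\<close>,
  and a permutation of \<open>{1..n}\<close> has no descent at \<open>a >= n\<close>. Removing that
  cross leaves a reduced product in the same group.\<close>

lemma reduced_swaps_bound:
  assumes "distinct xs" "\<And>x. x \<in> set xs \<Longrightarrow> 1 \<le> fst x \<and> 1 \<le> snd x"
    and "swaps S xs permutes {1..n}" "card (perm_inversions (swaps S xs)) = card (S \<inter> set xs)"
    and "x \<in> S \<inter> set xs"
  shows "fst x + snd x \<le> n"
  using assms
proof (induction xs arbitrary: x rule: rev_induct)
  case (snoc y xs)
  show ?case
  proof (cases "y \<in> S")
    case False
    then show ?thesis using snoc by (auto simp: swaps_snoc)
  next
    case True
    define a where "a = fst y + snd y - 1"
    have "1 \<le> fst y" "1 \<le> snd y" using snoc.prems(2)[of y] by auto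
    then have a: "1 \<le> a" "fst y + snd y = a + 1" unfolding a_def by linarith+
    let ?f = "swaps S (xs @ [y])" and ?g = "swaps S xs" and ?s = "transpose a (a + 1)"
    have f: "?f = ?g \<circ> ?s" using True a by (simp add: swaps_snoc)
    then have g: "?g = ?f \<circ> ?s" by (simp add: comp_assoc)
    have fin: "finite (perm_inversions ?g)" "card (perm_inversions ?g) \<le> card (S \<inter> set xs)"
      using card_inversions_swaps[of xs S] snoc.prems by auto
    have finf: "finite (perm_inversions ?f)"
      unfolding f by (rule finite_inversions_transpose) fact+
    have m: "card (S \<inter> set (xs @ [y])) = card (S \<inter> set xs) + 1"
      using True snoc.prems by simp
    \<comment> \<open>At an ascent \<open>?g\<close> would have more inversions than
      \<open>?f\<close>, hence more than it has crosses.\<close>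
    have "\<not> ?f a < ?f (a + 1)"
      using card_inversions_ascent[OF a(1) finf, folded g] fin m snoc.prems(4) by linarith
    moreover have inj: "inj ?f" using bij_swaps bij_is_inj by blast
    ultimately have desc: "?f (a + 1) < ?f a"
      by (metis inj_eq less_add_one nat_neq_iff)
    have an: "a + 1 \<le> n"
    proof (rule ccontr)
      assume "\<not> a + 1 \<le> n"
      then have 1: "?f (a + 1) = a + 1" using snoc.prems(3) permutes_not_in by fastforce
      \<comment> \<open>For \<open>a = n\<close> the value at \<open>n\<close> stays in
        \<open>{1..n}\<close>, and for larger \<open>a\<close> both values are fixed; neither allows
        a descent.\<close>
      show False
      proof (cases "a = n")
        case True
        then show ?thesis using 1 desc a permutes_in_image[OF snoc.prems(3), of a] by simp
      next
        case False
        then have "?f a = a" using \<open>\<not> a + 1 \<le> n\<close> snoc.prems(3) permutes_not_in by fastforce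
        then show ?thesis using 1 desc by simp
      qed
    qed
    have "?g permutes {1..n}" unfolding g
      by (rule permutes_compose[OF permutes_swap_id snoc.prems(3)]) (use a an in auto)
    moreover have "card (perm_inversions ?g) = card (S \<inter> set xs)"
      using finite_inversions_transpose(2)[OF a(1) fin(1), folded f] fin(2) m snoc.prems(4)
      by linarith
    ultimately show ?thesis using snoc an a by (cases "x = y") auto
  qed
qed simp

section \<open>Reduced pipe dreams: ladder moves, double crossings, size\<close>

lemma RPD_D:
  assumes "D \<in> RPD w"
  shows "finite D" "(i, j) \<in> D \<Longrightarrow> 1 \<le> i \<and> 1 \<le> j"
  using assms by (auto simp: RPD_def pipe_dream_def)

text \<open>The bound \<open>m\<close> makes room for the target column of a ladder move, which may
  lie right of all crosses.\<close>

lemma pipe_dream_bound: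
  assumes "pipe_dream D"
  obtains N where "m < N" "D \<subseteq> {1..<N} \<times> {1..<N}"
proof -
  have fin: "finite (fst ` D \<union> snd ` D)" using assms by (simp add: pipe_dream_def)
  obtain M where M: "\<And>x. x \<in> fst ` D \<union> snd ` D \<Longrightarrow> x \<le> M"
    using fin finite_nat_set_iff_bounded_le by metis
  have "D \<subseteq> {1..<Suc (max m M)} \<times> {1..<Suc (max m M)}"
  proof
    fix x assume x: "x \<in> D"
    then have "fst x \<le> M" "snd x \<le> M" "x \<in> {1..} \<times> {1..}"
      using M assms unfolding pipe_dream_def by blast+
    then show "x \<in> {1..<Suc (max m M)} \<times> {1..<Suc (max m M)}" by (cases x) auto
  qed
  then show ?thesis using that[of "Suc (max m M)"] by simp
qed

lemma inversions_cong: "(\<And>i. 1 \<le> i \<Longrightarrow> f i = g i) \<Longrightarrow> perm_inversions f = perm_inversions g"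
  unfolding perm_inversions_def by auto

lemma card_inversions_tiles:
  assumes "B \<subseteq> {1..<N} \<times> {1..<N}"
  shows "card (perm_inversions (swaps B (tiles N))) \<le> card B"
  using card_inversions_swaps[of "tiles N" B] assms
  by (auto simp: distinct_tiles set_tiles Int_absorb2)

lemma ladder_rectD:
  assumes "ladder_rect D i j h k"
  shows "1 \<le> h" "h < i" "1 \<le> j" "j < k" "(i, j) \<in> D" "(h, j) \<notin> D" "(i, k) \<notin> D" "(h, k) \<notin> D"
    and "\<And>p q. h \<le> p \<Longrightarrow> p \<le> i \<Longrightarrow> j \<le> q \<Longrightarrow> q \<le> k \<Longrightarrow> (p, q) \<noteq> (h, j) \<Longrightarrow> (p, q) \<noteq> (i, k) \<Longrightarrow>
      (p, q) \<noteq> (h, k) \<Longrightarrow> (p, q) \<in> D"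
  using assms unfolding ladder_rect_def by simp_all

text \<open>Both pipe dreams arise from the same \<open>?B\<close> by adding a cross at one of two
  opposite corners, so \<open>swaps_rect\<close> applies.\<close>

lemma RPD_ladder_move:
  assumes D: "D \<in> RPD w" and r: "ladder_rect D i j h k"
  shows "insert (h, k) (D - {(i, j)}) \<in> RPD w"
proof -
  let ?B = "D - {(i, j)}"
  obtain N where N: "k < N" "D \<subseteq> {1..<N} \<times> {1..<N}"
    using pipe_dream_bound[of D k] D unfolding RPD_def by blast
  have ij: "(i, j) \<in> D" "1 \<le> h" "h < i" "1 \<le> j" "j < k" "(h, k) \<notin> D" "(h, j) \<notin> D" "(i, k) \<notin> D"
    using ladder_rectD[OF r] by simp_all
  have iN: "i < N" using N ij by auto
  have B: "?B \<subseteq> {1..<N} \<times> {1..<N}" using N by blast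
  have "swaps (insert (h, k) ?B) (tiles N) = swaps (insert (i, j) ?B) (tiles N)"
  proof (rule swaps_rect(1)[OF B iN N(1)])
    fix p q assume "p \<in> {h..i}" "q \<in> {j..k}" "(p, q) \<notin> {(i, j), (h, j), (i, k), (h, k)}"
    then show "(p, q) \<in> ?B" using ladder_rectD(9)[OF r, of p q] by auto
  qed (use ij in auto)
  moreover have "insert (i, j) ?B = D" using ij by blast
  ultimately have eq: "swaps (insert (h, k) ?B) (tiles N) = swaps D (tiles N)" by simp
  interpret D: bounded_pipe_dream D N by standard fact
  interpret D': bounded_pipe_dream "insert (h, k) ?B" N
    by standard (use N iN ij in auto)
  have "card (insert (h, k) ?B) = card D"
    using card_Suc_Diff1[OF RPD_D(1)[OF D] ij(1)] ij RPD_D(1)[OF D] by simp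
  moreover have "has_perm (insert (h, k) ?B) w"
    using D unfolding D'.has_perm_iff eq RPD_def by (simp add: D.has_perm_iff)
  moreover have "pipe_dream (insert (h, k) ?B)"
    using D ij unfolding RPD_def pipe_dream_def by auto
  ultimately show ?thesis using D unfolding RPD_def by simp
qed

text \<open>The same two pipes would cross at \<open>(i, j)\<close> and at \<open>(h, k)\<close>;
  dropping both crosses keeps the permutation but leaves fewer crosses than inversions.\<close>

lemma RPD_no_double_crossing:
  assumes D: "D \<in> RPD w" and "1 \<le> h" "h < i" "1 \<le> j" "j < k"
    and bumps: "(h, j) \<notin> D" "(i, k) \<notin> D"
    and cross: "\<And>p q. p \<in> {h..i} \<Longrightarrow> q \<in> {j..k} \<Longrightarrow> (p, q) \<noteq> (h, j) \<Longrightarrow> (p, q) \<noteq> (i, k) \<Longrightarrow> (p, q) \<in> D"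
  shows False
proof -
  let ?B = "D - {(i, j), (h, k)}"
  have "pipe_dream D" using D by (simp add: RPD_def)
  then obtain N where N: "D \<subseteq> {1..<N} \<times> {1..<N}"
    by (rule pipe_dream_bound[of D 0])
  have c: "(i, j) \<in> D" "(h, k) \<in> D" using cross[of i j] cross[of h k] assms by auto
  have ijN: "i < N" "k < N" using c N by auto
  have B: "?B \<subseteq> {1..<N} \<times> {1..<N}" using N by blast
  have "swaps (insert (h, k) (insert (i, j) ?B)) (tiles N) = swaps ?B (tiles N)"
    by (rule swaps_rect(2)[OF B]) (use assms ijN c in auto)
  moreover have "insert (h, k) (insert (i, j) ?B) = D" using c by blast
  ultimately have eq: "swaps D (tiles N) = swaps ?B (tiles N)" by simp
  interpret bounded_pipe_dream D N by standard fact
  have "perm_inversions w = perm_inversions (swaps ?B (tiles N))"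
    using D has_perm_iff eq by (intro inversions_cong) (auto simp: RPD_def)
  then have "card D \<le> card ?B" using D card_inversions_tiles[OF B] by (simp add: RPD_def)
  moreover have "card ?B < card D" by (rule psubset_card_mono) (use c RPD_D(1)[OF D] in auto)
  ultimately show False by simp
qed

lemma RPD_bound:
  assumes w: "w permutes {1..n}" and D: "D \<in> RPD w" and x: "(i, j) \<in> D"
  shows "i + j \<le> n"
proof -
  have "pipe_dream D" using D by (simp add: RPD_def)
  then obtain N where N: "D \<subseteq> {1..<N} \<times> {1..<N}"
    by (rule pipe_dream_bound[of D 0])
  interpret bounded_pipe_dream D N by standard fact
  \<comment> \<open>The argument 0 is not covered by \<open>has_perm\<close> and is treated
    separately to get equality of functions.\<close>
  have "swaps D (tiles N) 0 = 0" by (rule swaps_fixes) (auto simp: set_tiles)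
  moreover have "w 0 = 0" using w permutes_not_in by fastforce
  moreover have "\<forall>i\<ge>1. w i = swaps D (tiles N) i" using D has_perm_iff by (simp add: RPD_def)
  ultimately have "w m = swaps D (tiles N) m" for m by (cases "m = 0") auto
  then have "w = swaps D (tiles N)" by blast
  moreover have "D \<inter> set (tiles N) = D" using N by (auto simp: set_tiles)
  ultimately show ?thesis
    using reduced_swaps_bound[of "tiles N" D n "(i, j)"] w D x
    by (auto simp: distinct_tiles set_tiles RPD_def)
qed

subsection \<open>Frames and sweeps\<close>

lemma pair_set_eqI: "(\<And>r c. (r, c) \<in> A \<longleftrightarrow> (r, c) \<in> B) \<Longrightarrow> A = B"
  by auto

text \<open>For a cross \<open>(i, j)\<close> this identifies its rectangle without reference to
  \<open>n\<close>, \<open>Max\<close> or \<open>Min\<close>.\<close>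

definition frame :: "(nat \<times> nat) set \<Rightarrow> nat \<Rightarrow> nat \<Rightarrow> nat \<Rightarrow> nat \<Rightarrow> bool" where
  "frame D h i j k \<longleftrightarrow> 1 \<le> h \<and> h < i \<and> 1 \<le> j \<and> j < k \<and> (h, j) \<notin> D \<and> (i, k) \<notin> D \<and>
     (\<forall>r. h < r \<longrightarrow> r \<le> i \<longrightarrow> (r, j) \<in> D) \<and> (\<forall>c. j \<le> c \<longrightarrow> c < k \<longrightarrow> (i, c) \<in> D)"

text \<open>Together with a bump in row \<open>a\<close> of the rectangle, this characterizes
  \<open>a\<close> as \<open>rect_a\<close>.\<close>

definition full_rows :: "(nat \<times> nat) set \<Rightarrow> nat \<Rightarrow> nat \<Rightarrow> nat \<Rightarrow> nat \<Rightarrow> bool" where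
  "full_rows D a i j k \<longleftrightarrow> (\<forall>r c. a < r \<longrightarrow> r < i \<longrightarrow> j \<le> c \<longrightarrow> c \<le> k \<longrightarrow> (r, c) \<in> D)"

text \<open>The composite of ladder moves in row \<open>i\<close> from right to left: the cross
  below each bump of row \<open>h\<close> left of column \<open>k\<close> goes to the next bump of
  row \<open>h\<close>. Only \<open>(h, j)\<close> is not filled.\<close>

definition sweep :: "(nat \<times> nat) set \<Rightarrow> nat \<Rightarrow> nat \<Rightarrow> nat \<Rightarrow> nat \<Rightarrow> (nat \<times> nat) set" where
  "sweep D h i j k =
     (D - {(r, c). r = i \<and> j \<le> c \<and> c \<le> k \<and> (h, c) \<notin> D}) \<union> {(r, c). r = h \<and> j < c \<and> c \<le> k}"

text \<open>
  \<open>move_rel D h i j k E\<close> stands for \<open>E = \<M>\<^sub>i\<^sub>j(D)\<close>, where \<open>[h,i] \<times> [j,k]\<close> is the rectangle of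
  \<open>(i, j)\<close> in \<open>D\<close>. After row \<open>a\<close> has been emptied no bump is left strictly between rows \<open>a\<close> and \<open>i\<close>,
  so that the outer call of case (ii) is a single sweep.
\<close>

inductive move_rel :: "(nat \<times> nat) set \<Rightarrow> nat \<Rightarrow> nat \<Rightarrow> nat \<Rightarrow> nat \<Rightarrow> (nat \<times> nat) set \<Rightarrow> bool"
  for D h where
  base: "frame D h i j k \<Longrightarrow> full_rows D h i j k \<Longrightarrow> (h, k) \<notin> D \<Longrightarrow> move_rel D h i j k (sweep D h i j k)"
| row: "frame D h i j k \<Longrightarrow> h < a \<Longrightarrow> a < i \<Longrightarrow> full_rows D a i j k \<Longrightarrow> c \<le> k \<Longrightarrow> move_rel D h a j c E \<Longrightarrow>
    (a, k) \<notin> E \<Longrightarrow> move_rel D h i j k (sweep E a i j k)"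

lemma mem_sweep:
  "(r, c) \<in> sweep D h i j k \<longleftrightarrow>
    r = h \<and> j < c \<and> c \<le> k \<or> (r, c) \<in> D \<and> \<not> (r = i \<and> j \<le> c \<and> c \<le> k \<and> (h, c) \<notin> D)"
  by (auto simp: sweep_def)

lemma frameD:
  assumes "frame D h i j k"
  shows "1 \<le> h" "h < i" "1 \<le> j" "j < k" "(h, j) \<notin> D" "(i, k) \<notin> D"
    "\<And>r. h < r \<Longrightarrow> r \<le> i \<Longrightarrow> (r, j) \<in> D" "\<And>c. j \<le> c \<Longrightarrow> c < k \<Longrightarrow> (i, c) \<in> D"
  using assms by (auto simp: frame_def)

lemma full_rowsD:
  "full_rows D a i j k \<Longrightarrow> a < r \<Longrightarrow> r < i \<Longrightarrow> j \<le> c \<Longrightarrow> c \<le> k \<Longrightarrow> (r, c) \<in> D"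
  by (simp add: full_rows_def)

lemma move_rel_frame: "move_rel D h i j k E \<Longrightarrow> frame D h i j k"
  by (erule move_rel.cases) auto

lemma move_rel_outside:
  "move_rel D h i j k E \<Longrightarrow> \<not> (h \<le> p \<and> p \<le> i \<and> j \<le> q \<and> q \<le> k) \<Longrightarrow> (p, q) \<in> E \<longleftrightarrow> (p, q) \<in> D"
proof (induction rule: move_rel.induct)
  case (base i j k)
  then show ?case using frameD(2)[OF base(1)] by (auto simp: mem_sweep)
next
  case (row i j k a c E)
  then show ?case using frameD(2)[OF row(1)] by (auto simp: mem_sweep)
qed

lemma move_rel_corners: "move_rel D h i j k E \<Longrightarrow> (i, j) \<notin> E \<and> (h, j) \<notin> E \<and> (i, k) \<notin> E"
proof (induction rule: move_rel.induct)
  case (base i j k)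
  then show ?case using frameD(1-6)[OF base(1)] by (simp add: mem_sweep)
next
  case (row i j k a c E)
  have "(i, k) \<notin> E" using move_rel_outside[OF row(6), of i k] row(3) frameD(6)[OF row(1)] by simp
  then show ?case using row frameD(1-6)[OF row(1)] by (simp add: mem_sweep)
qed

lemma move_rel_below: "move_rel D h a j c E \<Longrightarrow> a < r \<Longrightarrow> (r, q) \<in> E \<longleftrightarrow> (r, q) \<in> D"
  using move_rel_outside[of D h a j c E r q] by simp

lemma move_rel_frame_below:
  assumes "move_rel D h a j c E" "frame D h i j k" "a < i"
  shows "frame E a i j k"
  unfolding frame_def
  using assms frameD[OF assms(2)] frameD(1,2)[OF move_rel_frame[OF assms(1)]] move_rel_corners[OF assms(1)]
    move_rel_below[OF assms(1)] by simp

lemma move_rel_full_rows_below: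
  "move_rel D h a j c E \<Longrightarrow> full_rows E a i j k \<longleftrightarrow> full_rows D a i j k"
  unfolding full_rows_def using move_rel_below by blast

text \<open>Neither the frame conditions nor the sweeps look outside the rectangle, so a run
  transfers to any set that agrees on it.\<close>

lemma move_rel_local:
  assumes "move_rel D h i j k E"
    and "\<And>p q. h \<le> p \<Longrightarrow> p \<le> i \<Longrightarrow> j \<le> q \<Longrightarrow> q \<le> k \<Longrightarrow> (p, q) \<in> D1 \<longleftrightarrow> (p, q) \<in> D"
  shows "\<exists>E1. move_rel D1 h i j k E1 \<and>
    (\<forall>p q. (p, q) \<in> E1 \<longleftrightarrow> (if h \<le> p \<and> p \<le> i \<and> j \<le> q \<and> q \<le> k then (p, q) \<in> E else (p, q) \<in> D1))"
  using assms
proof (induction rule: move_rel.induct)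
  case (base i j k)
  note f = frameD[OF base(1)]
  have "frame D1 h i j k" unfolding frame_def using f base(4) by simp
  moreover have "full_rows D1 h i j k" using base(2) base(4) by (simp add: full_rows_def)
  moreover have "(h, k) \<notin> D1" using base(3,4) f by simp
  ultimately have "move_rel D1 h i j k (sweep D1 h i j k)" by (rule move_rel.base)
  then show ?case
    by (rule exI[of _ "sweep D1 h i j k", OF conjI]) (use base(4) f in \<open>auto simp: mem_sweep\<close>)
next
  case (row i j k a c E)
  note f = frameD[OF row(1)]
  have "\<exists>E1. move_rel D1 h a j c E1 \<and>
    (\<forall>p q. (p, q) \<in> E1 \<longleftrightarrow> (if h \<le> p \<and> p \<le> a \<and> j \<le> q \<and> q \<le> c then (p, q) \<in> E else (p, q) \<in> D1))"
    by (rule row.IH) (use row in auto)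
  then obtain E1 where E1: "move_rel D1 h a j c E1" and
    E1_iff: "\<And>p q. (p, q) \<in> E1 \<longleftrightarrow> (if h \<le> p \<and> p \<le> a \<and> j \<le> q \<and> q \<le> c then (p, q) \<in> E else (p, q) \<in> D1)"
    by blast
  have agree: "(p, q) \<in> E1 \<longleftrightarrow> (p, q) \<in> E" if "h \<le> p" "p \<le> i" "j \<le> q" "q \<le> k" for p q
    using that E1_iff[of p q] move_rel_outside[OF row(6), of p q] row.prems[of p q] by auto
  have out: "(p, q) \<in> E1 \<longleftrightarrow> (p, q) \<in> D1" if "\<not> (h \<le> p \<and> p \<le> i \<and> j \<le> q \<and> q \<le> k)" for p q
    using that E1_iff[of p q] row(2-5) by auto
  have "frame D1 h i j k" unfolding frame_def using f row.prems by simp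
  moreover have "full_rows D1 a i j k" using row(2,4) row.prems by (simp add: full_rows_def)
  moreover have "(a, k) \<notin> E1" using row(2,3,7) f agree[of a k] by simp
  ultimately have "move_rel D1 h i j k (sweep E1 a i j k)" using move_rel.row row(2,3,5) E1 by blast
  then show ?case
    by (rule exI[of _ "sweep E1 a i j k", OF conjI]) (use agree out f row(2,3) in \<open>auto simp: mem_sweep\<close>)
qed

text \<open>The ladder move changes no tile of the frame, and by \<open>agree\<close> the run
  changes no tile of the ladder rectangle.\<close>

lemma move_rel_commute:
  assumes E: "move_rel D h i j k E" and r: "ladder_rect D p q h' k'"
    and corners: "\<not> (h \<le> p \<and> p \<le> i \<and> j \<le> q \<and> q \<le> k)" "\<not> (h \<le> h' \<and> h' \<le> i \<and> j \<le> k' \<and> k' \<le> k)"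
    and agree: "\<And>r c. h' \<le> r \<Longrightarrow> r \<le> p \<Longrightarrow> q \<le> c \<Longrightarrow> c \<le> k' \<Longrightarrow> h \<le> r \<Longrightarrow> r \<le> i \<Longrightarrow> j \<le> c \<Longrightarrow> c \<le> k \<Longrightarrow>
      (r, c) \<in> E \<longleftrightarrow> (r, c) \<in> D"
  shows "ladder_rect E p q h' k'"
    and "move_rel (insert (h', k') (D - {(p, q)})) h i j k (insert (h', k') (E - {(p, q)}))"
proof -
  have "(r, c) \<in> E \<longleftrightarrow> (r, c) \<in> D" if "h' \<le> r" "r \<le> p" "q \<le> c" "c \<le> k'" for r c
    using that agree[of r c] move_rel_outside[OF E, of r c] by blast
  then show "ladder_rect E p q h' k'" using r unfolding ladder_rect_def by simp
  let ?D1 = "insert (h', k') (D - {(p, q)})" and ?E1 = "insert (h', k') (E - {(p, q)})"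
  obtain E1 where E1: "move_rel ?D1 h i j k E1" and
    iff: "\<And>r c. (r, c) \<in> E1 \<longleftrightarrow> (if h \<le> r \<and> r \<le> i \<and> j \<le> c \<and> c \<le> k then (r, c) \<in> E else (r, c) \<in> ?D1)"
    using move_rel_local[OF E, of ?D1] corners by blast
  have "E1 = ?E1"
  proof (rule pair_set_eqI)
    fix r c show "(r, c) \<in> E1 \<longleftrightarrow> (r, c) \<in> ?E1"
      using iff[of r c] move_rel_outside[OF E, of r c] corners by auto
  qed
  with E1 show "move_rel ?D1 h i j k ?E1" by simp
qed

text \<open>The recursion may also be entered at a row \<open>a\<close> that is not the lowest one with a bump, as
  long as the first bump of every lower row lies weakly to the right of the first bump of row \<open>a\<close>.\<close>
lemma move_rel_via_row:
  assumes "move_rel D2 a i j k F" "move_rel D h a j c D2" "frame D h i j k"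
    and "\<And>r q. a < r \<Longrightarrow> r \<le> i \<Longrightarrow> j \<le> q \<Longrightarrow> q < c \<Longrightarrow> (r, q) \<in> D"
  shows "move_rel D h i j k F"
  using assms
proof (induction rule: move_rel.induct)
  case (base i j k)
  have "h < a" using move_rel_frame[OF base(4)] frameD by blast
  have "a < i" using base(1) frameD by blast
  have "c \<le> k"
  proof (rule ccontr)
    assume "\<not> c \<le> k"
    then have "(i, k) \<in> D" using base(6)[of i k] \<open>a < i\<close> frameD(4)[OF base(1)] by simp
    with frameD(6)[OF base(5)] show False ..
  qed
  with \<open>h < a\<close> \<open>a < i\<close> base show ?case
    by (intro move_rel.row) (auto simp: move_rel_full_rows_below[OF base(4)])
next
  case (row i j k a1 c1 E)
  have "h < a" using move_rel_frame[OF row(9)] frameD by blast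
  have f1: "frame D2 a a1 j c1" using move_rel_frame row by blast
  have fr: "frame D h a1 j c1"
    unfolding frame_def using frameD[OF f1] frameD[OF row(10)] \<open>h < a\<close> row(2,3)
      move_rel_below[OF row(9), of a1] by simp
  \<comment> \<open>By induction the run of \<open>D2\<close> that empties row \<open>a1\<close>
    extends to a run of \<open>D\<close> from \<open>h\<close>, the inner run that
    \<open>move_rel.row\<close> requires.\<close>
  have "move_rel D h a1 j c1 E" using row.IH[OF row(9) fr] row(2,3) row(11) by simp
  moreover have "full_rows D a1 i j k"
    using row(2,4) move_rel_below[OF row(9)] unfolding full_rows_def by (meson less_trans)
  ultimately show ?case using row(2,3,5,7,10) \<open>h < a\<close> by (intro move_rel.row) auto
qed

lemma ladder_rect_frame: "ladder_rect D i j h k \<Longrightarrow> frame D h i j k"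
  unfolding frame_def using ladder_rectD[of D i j h k] by auto

text \<open>Row \<open>h\<close> has bumps only at columns \<open>j\<close> and \<open>k\<close> of
  the rectangle, so its sweep just exchanges two corners.\<close>

lemma move_rel_ladder:
  assumes r: "ladder_rect D i j h k"
  shows "move_rel D h i j k (insert (h, k) (D - {(i, j)}))"
proof -
  note d = ladder_rectD[OF r]
  have "full_rows D h i j k" unfolding full_rows_def using d by auto
  with r d have "move_rel D h i j k (sweep D h i j k)" by (intro move_rel.base ladder_rect_frame)
  moreover have "sweep D h i j k = insert (h, k) (D - {(i, j)})"
  proof (rule pair_set_eqI)
    fix r c show "(r, c) \<in> sweep D h i j k \<longleftrightarrow> (r, c) \<in> insert (h, k) (D - {(i, j)})"
      using d(1-8) d(9)[of h c] by (cases "c = k") (auto simp: mem_sweep)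
  qed
  ultimately show ?thesis by simp
qed


text \<open>If \<open>(h, k)\<close> were a cross, the last bump \<open>(h, b)\<close> of row
  \<open>h\<close> and \<open>(i, k)\<close> would bound a double crossing.\<close>

lemma RPD_full_corner:
  assumes D: "D \<in> RPD w" and f: "frame D h i j k" and full: "full_rows D h i j k"
  shows "(h, k) \<notin> D"
proof
  assume hk: "(h, k) \<in> D"
  note fr = frameD[OF f]
  define b where "b = Max {b \<in> {j..k}. (h, b) \<notin> D}"
  have fin: "finite {b \<in> {j..k}. (h, b) \<notin> D}" "{b \<in> {j..k}. (h, b) \<notin> D} \<noteq> {}"
    using fr(4,5) by (auto intro: exI[of _ j])
  have b: "j \<le> b" "b \<le> k" "(h, b) \<notin> D" using Max_in[OF fin] by (auto simp: b_def)
  have right: "(h, q) \<in> D" if "b < q" "q \<le> k" for q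
    using Max_ge[OF fin(1), of q] that b(1) unfolding b_def[symmetric] by fastforce
  have "b < k" using b hk le_neq_implies_less by blast
  show False
  proof (rule RPD_no_double_crossing[OF D fr(1,2) _ \<open>b < k\<close> b(3) fr(6)])
    fix p q assume pq: "p \<in> {h..i}" "q \<in> {b..k}" "(p, q) \<noteq> (h, b)" "(p, q) \<noteq> (i, k)"
    consider "p = h" | "p = i" | "h < p" "p < i" using pq by force
    then show "(p, q) \<in> D"
    proof cases
      case 1
      then show ?thesis using right[of q] pq by auto
    next
      case 2
      then show ?thesis using fr(8)[of q] pq b by auto
    next
      case 3
      then show ?thesis using full_rowsD[OF full, of p q] pq b by auto
    qed
  qed (use fr b in simp)
qed

section \<open>Paths of ladder moves and the row sum\<close>

lemma ladder_step_NE_iff: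
  "ladder_step_NE i j D D' \<longleftrightarrow>
    (\<exists>p q h k. p \<le> i \<and> j \<le> q \<and> ladder_rect D p q h k \<and> D' = insert (h, k) (D - {(p, q)}))"
  unfolding ladder_step_NE_def ladder_movable_def by (metis ladder_move_eq)

lemma ladder_step_NE_imp_ladder_step: "ladder_step_NE i j D D' \<Longrightarrow> ladder_step D D'"
  unfolding ladder_step_NE_def ladder_step_def by blast

lemma ladder_step_NE_mono: "i' \<le> i \<Longrightarrow> j \<le> j' \<Longrightarrow> ladder_step_NE i' j' D D' \<Longrightarrow> ladder_step_NE i j D D'"
  unfolding ladder_step_NE_def by (metis order_trans)

lemma NE_tranclp_mono:
  "(ladder_step_NE i' j')\<^sup>+\<^sup>+ D D' \<Longrightarrow> i' \<le> i \<Longrightarrow> j \<le> j' \<Longrightarrow> (ladder_step_NE i j)\<^sup>+\<^sup>+ D D'"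
  by (induction rule: tranclp_induct) (blast intro: ladder_step_NE_mono tranclp.intros)+

lemma NE_rtranclp_mono:
  "(ladder_step_NE i' j')\<^sup>*\<^sup>* D D' \<Longrightarrow> i' \<le> i \<Longrightarrow> j \<le> j' \<Longrightarrow> (ladder_step_NE i j)\<^sup>*\<^sup>* D D'"
  by (erule rtranclp_mono[THEN predicate2D, rotated]) (auto intro: ladder_step_NE_mono)

lemma NE_rtranclp_imp_ladder_steps: "(ladder_step_NE i j)\<^sup>*\<^sup>* D D' \<Longrightarrow> ladder_step\<^sup>*\<^sup>* D D'"
  by (erule rtranclp_mono[THEN predicate2D, rotated]) (auto intro: ladder_step_NE_imp_ladder_step)

lemma RPD_ladder_step: "D \<in> RPD w \<Longrightarrow> ladder_step D D' \<Longrightarrow> D' \<in> RPD w"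
  unfolding ladder_step_def ladder_movable_def using RPD_ladder_move ladder_move_eq by metis

lemma RPD_ladder_steps: "ladder_step\<^sup>*\<^sup>* D D' \<Longrightarrow> D \<in> RPD w \<Longrightarrow> D' \<in> RPD w"
  by (induction rule: rtranclp_induct) (auto intro: RPD_ladder_step)

lemma RPD_NE_steps: "(ladder_step_NE i j)\<^sup>*\<^sup>* D D' \<Longrightarrow> D \<in> RPD w \<Longrightarrow> D' \<in> RPD w"
  using NE_rtranclp_imp_ladder_steps RPD_ladder_steps by blast

definition row_sum :: "(nat \<times> nat) set \<Rightarrow> nat" where
  "row_sum D = (\<Sum>x\<in>D. fst x)"

lemma ladder_step_row_sum:
  assumes "D \<in> RPD w" "ladder_step D D'"
  shows "row_sum D' < row_sum D"
proof -
  obtain p q h k where r: "ladder_rect D p q h k" and D': "D' = insert (h, k) (D - {(p, q)})"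
    using assms(2) ladder_move_eq unfolding ladder_step_def ladder_movable_def by metis
  note d = ladder_rectD[OF r]
  have fin: "finite D" using RPD_D(1)[OF assms(1)] .
  have "row_sum D = p + (\<Sum>x\<in>D - {(p, q)}. fst x)"
    unfolding row_sum_def using sum.remove[OF fin d(5), of fst] by simp
  moreover have "row_sum D' = h + (\<Sum>x\<in>D - {(p, q)}. fst x)"
    unfolding row_sum_def D' using fin d(8) by simp
  ultimately show ?thesis using d(2) by simp
qed

lemma ladder_steps_row_sum:
  assumes "ladder_step\<^sup>*\<^sup>* D D'" "D \<in> RPD w"
  shows "D' = D \<or> row_sum D' < row_sum D"
  using assms
proof (induction rule: rtranclp_induct)
  case (step D1 D2)
  then show ?case using ladder_step_row_sum[OF RPD_ladder_steps[OF step(1) step(4)] step(2)] by auto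
qed simp

lemma NE_tranclp_row_sum:
  assumes "(ladder_step_NE i j)\<^sup>+\<^sup>+ D D'" "D \<in> RPD w"
  shows "row_sum D' < row_sum D"
proof -
  obtain D1 where "ladder_step D D1" "ladder_step\<^sup>*\<^sup>* D1 D'"
    using tranclpD[OF assms(1)] ladder_step_NE_imp_ladder_step NE_rtranclp_imp_ladder_steps by blast
  then show ?thesis
    using ladder_step_row_sum ladder_steps_row_sum RPD_ladder_step assms(2) by (metis order.strict_trans)
qed

text \<open>The new cross lies strictly above row \<open>i\<close>.\<close>

lemma NE_step_keeps_bump:
  assumes "ladder_step_NE i j D D'" "(i, j) \<in> D'"
  shows "(i, j) \<in> D"
  using assms ladder_rectD(2) unfolding ladder_step_NE_iff by (metis DiffD1 fst_conv insertE leD)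

lemma NE_steps_keep_bump:
  "(ladder_step_NE i j)\<^sup>*\<^sup>* D D' \<Longrightarrow> (i, j) \<in> D' \<Longrightarrow> (i, j) \<in> D"
  by (induction rule: rtranclp_induct) (auto dest: NE_step_keeps_bump)

text \<open>The new cross lies strictly right of column \<open>j\<close>, so no bump of that column
  is filled.\<close>

lemma NE_step_keeps_movable:
  assumes "ladder_step_NE i j D D'" "movable i j D" "(i, j) \<in> D'"
  shows "movable i j D'"
proof -
  obtain p q h k where r: "j \<le> q" "ladder_rect D p q h k" "D' = insert (h, k) (D - {(p, q)})"
    using assms(1) unfolding ladder_step_NE_iff by blast
  then have "j < k" using ladder_rectD(4)[OF r(2)] by simp
  with r assms show ?thesis unfolding movable_def by auto
qed

section \<open>Evaluating the recursion on frames\<close>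

lemma rect_h_frame:
  assumes "frame D h i j k"
  shows "rect_h i j D = h"
  unfolding rect_h_def using frameD[OF assms]
  by (intro Max_eqI) (auto simp: not_less[symmetric])

lemma rect_k_frame:
  assumes "frame D h i j k" "k \<le> n"
  shows "rect_k n i j D = k"
  unfolding rect_k_def
proof (rule Min_eqI)
  fix c assume "c \<in> {c \<in> {j + 1..n}. (i, c) \<notin> D}"
  then show "k \<le> c" using frameD(8)[OF assms(1), of c] by (cases "c < k") auto
qed (use frameD[OF assms(1)] assms(2) in auto)

lemma movable_frame: "frame D h i j k \<Longrightarrow> movable i j D"
  unfolding movable_def using frameD[of D h i j k] by auto

lemma rect_a_eq:
  assumes "frame D h i j k" "k \<le> n" "h \<le> a" "a < i" "full_rows D a i j k"
    and "j \<le> q" "q \<le> k" "(a, q) \<notin> D"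
  shows "rect_a n i j D = a"
  unfolding rect_a_def rect_h_frame[OF assms(1)] rect_k_frame[OF assms(1,2)]
proof (rule Max_eqI)
  fix p assume "p \<in> {p \<in> {h..<i}. \<exists>q\<in>{j..k}. (p, q) \<notin> D}"
  then show "p \<le> a" using full_rowsD[OF assms(5), of p] by (auto simp: not_less[symmetric])
qed (use assms in auto)

lemma rect_b_eq:
  assumes "frame D h i j k" "k \<le> n" "full_rows D h i j k" "j < b" "b \<le> k" "(h, b) \<notin> D"
    and "\<And>c. j < c \<Longrightarrow> c < b \<Longrightarrow> (h, c) \<in> D"
  shows "rect_b n i j D = b"
  unfolding rect_b_def rect_h_frame[OF assms(1)] rect_k_frame[OF assms(1,2)]
proof (rule Min_eqI)
  fix c assume "c \<in> {q \<in> {j<..k}. \<exists>p\<in>{h..i}. (p, q) \<notin> D}"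
  then obtain p where c: "j < c" "c \<le> k" "h \<le> p" "p \<le> i" "(p, c) \<notin> D" by auto
  show "b \<le> c"
  proof (rule ccontr)
    assume "\<not> b \<le> c"
    then have "p \<noteq> h" "p \<noteq> i" using c assms(5,7) frameD(8)[OF assms(1), of c] by auto
    then show False using c full_rowsD[OF assms(3), of p c] by simp
  qed
qed (use assms frameD[OF assms(1)] in auto)

text \<open>Each case of the recursion gets one lemma giving domain membership and value together,
  because the outer call of a nested case takes the inner value as argument.\<close>

lemma move_op_ladder:
  assumes r: "ladder_rect D i j h k" and "k \<le> n"
  shows "move_op_dom (n, i, j, D)" "move_op n i j D = insert (h, k) (D - {(i, j)})"
proof -
  note d = ladder_rectD[OF r]
  have f: "frame D h i j k" by (rule ladder_rect_frame[OF r])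
  have full: "full_rows D h i j k" unfolding full_rows_def using d by auto
  have a: "rect_a n i j D = h"
    by (rule rect_a_eq[OF f \<open>k \<le> n\<close> _ _ full, of k]) (use d in auto)
  have b: "rect_b n i j D = k"
    by (rule rect_b_eq[OF f \<open>k \<le> n\<close> full]) (use d in auto)
  note eqs = a b rect_h_frame[OF f] rect_k_frame[OF f \<open>k \<le> n\<close>] movable_frame[OF f]
  show dom: "move_op_dom (n, i, j, D)"
    by (rule move_op.domintros) (simp_all add: eqs)
  show "move_op n i j D = insert (h, k) (D - {(i, j)})"
    by (simp add: move_op.psimps[OF dom] eqs ladder_move_eq[OF r])
qed

lemma move_op_row:
  assumes f: "frame D h i j k" and "k \<le> n" and a: "h < a" "a < i" "full_rows D a i j k"
    and q: "j \<le> q" "q \<le> k" "(a, q) \<notin> D"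
    and dom1: "move_op_dom (n, a, j, D)" and dom2: "move_op_dom (n, i, j, move_op n a j D)"
  shows "move_op_dom (n, i, j, D)" "move_op n i j D = move_op n i j (move_op n a j D)"
proof -
  have "rect_a n i j D = a"
    by (rule rect_a_eq[OF f \<open>k \<le> n\<close> _ a(2,3) q]) (use a in simp)
  note eqs = this rect_h_frame[OF f] rect_k_frame[OF f \<open>k \<le> n\<close>] movable_frame[OF f]
  show dom: "move_op_dom (n, i, j, D)"
    by (rule move_op.domintros) (use a dom1 dom2 in \<open>simp_all add: eqs\<close>)
  show "move_op n i j D = move_op n i j (move_op n a j D)"
    using a by (simp add: move_op.psimps[OF dom] eqs)
qed

lemma move_op_col:
  assumes f: "frame D h i j k" and "k \<le> n" and full: "full_rows D h i j k"
    and b: "j < b" "b < k" "(h, b) \<notin> D" "\<And>c. j < c \<Longrightarrow> c < b \<Longrightarrow> (h, c) \<in> D"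
    and dom1: "move_op_dom (n, i, b, D)" and dom2: "move_op_dom (n, i, j, move_op n i b D)"
  shows "move_op_dom (n, i, j, D)" "move_op n i j D = move_op n i j (move_op n i b D)"
proof -
  have 1: "rect_a n i j D = h"
    by (rule rect_a_eq[OF f \<open>k \<le> n\<close> _ _ full, of j]) (use frameD[OF f] in auto)
  have 2: "rect_b n i j D = b"
    by (rule rect_b_eq[OF f \<open>k \<le> n\<close> full]) (use b in auto)
  note eqs = 1 2 rect_h_frame[OF f] rect_k_frame[OF f \<open>k \<le> n\<close>] movable_frame[OF f]
  show dom: "move_op_dom (n, i, j, D)"
    by (rule move_op.domintros) (use b dom1 dom2 in \<open>simp_all add: eqs\<close>)
  show "move_op n i j D = move_op n i j (move_op n i b D)"
    using b by (simp add: move_op.psimps[OF dom] eqs)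
qed

text \<open>Induction on the width: the inner call at \<open>(i, b)\<close> has a narrower frame,
  and its sweep turns \<open>[h,i] x [j,b]\<close> into a ladder rectangle.\<close>

lemma move_op_sweep:
  assumes "frame D h i j k" "full_rows D h i j k" "(h, k) \<notin> D" "k \<le> n"
  shows "move_op_dom (n, i, j, D) \<and> move_op n i j D = sweep D h i j k \<and>
    (ladder_step_NE i j)\<^sup>+\<^sup>+ D (sweep D h i j k)"
  using assms
proof (induction "k - j" arbitrary: j rule: less_induct)
  case less
  note f = frameD[OF less(2)] and full = full_rowsD[OF less(3)]
  show ?case
  proof (cases "\<exists>c. j < c \<and> c < k \<and> (h, c) \<notin> D")
    case False
    have r: "ladder_rect D i j h k"
      unfolding ladder_rect_def
    proof (intro conjI ballI impI)
      fix p q assume pq: "p \<in> {h..i}" "q \<in> {j..k}" "(p, q) \<notin> {(h, j), (i, k), (h, k)}"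
      consider "p = h" | "p = i" | "h < p" "p < i" using pq by force
      then show "(p, q) \<in> D"
      proof cases
        case 1
        then have "j < q" "q < k" using pq by (auto simp: le_less)
        then show ?thesis using 1 False by blast
      next
        case 2
        then show ?thesis using f(8)[of q] pq by auto
      next
        case 3
        then show ?thesis using full[of p q] pq by auto
      qed
    qed (use f less.prems in auto)
    have "sweep D h i j k = insert (h, k) (D - {(i, j)})"
    proof (rule pair_set_eqI)
      fix r c show "(r, c) \<in> sweep D h i j k \<longleftrightarrow> (r, c) \<in> insert (h, k) (D - {(i, j)})"
        using False f(1-6) less.prems(3) by (cases "c = k"; cases "c = j") (auto simp: mem_sweep)
    qed
    then show ?thesis
      using move_op_ladder[OF r less.prems(4)] r ladder_step_NE_iff by (metis order_refl tranclp.r_into_trancl)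
  next
    case True
    \<comment> \<open>The interior rows and the bottom row have no bump left of column
      \<open>k\<close>, so row \<open>h\<close> alone determines \<open>rect_b\<close>.\<close>
    define b where "b = (LEAST c. j < c \<and> (h, c) \<notin> D)"
    obtain c0 where c0: "j < c0" "c0 < k" "(h, c0) \<notin> D" using True by blast
    have b: "j < b" "(h, b) \<notin> D" "b < k"
      using LeastI[of "\<lambda>c. j < c \<and> (h, c) \<notin> D" c0] Least_le[of "\<lambda>c. j < c \<and> (h, c) \<notin> D" c0] c0
      unfolding b_def by auto
    have gap: "(h, c) \<in> D" if "j < c" "c < b" for c
      using not_less_Least[of c "\<lambda>c. j < c \<and> (h, c) \<notin> D"] that unfolding b_def by blast
    let ?D' = "sweep D h i b k"
    have "(r, b) \<in> D" if "h < r" "r \<le> i" for r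
      using that full[of r b] f(8)[of b] b by (cases "r = i") auto
    then have fb: "frame D h i b k"
      unfolding frame_def using f b by auto
    have fullb: "full_rows D h i b k" using less(3) b(1) unfolding full_rows_def by auto
    have IH: "move_op_dom (n, i, b, D)" "move_op n i b D = ?D'" "(ladder_step_NE i b)\<^sup>+\<^sup>+ D ?D'"
      using less(1)[OF _ fb fullb less.prems(3,4)] b by auto
    have r: "ladder_rect ?D' i j h b"
      unfolding ladder_rect_def
    proof (intro conjI ballI impI)
      fix p q assume pq: "p \<in> {h..i}" "q \<in> {j..b}" "(p, q) \<notin> {(h, j), (i, b), (h, b)}"
      consider "p = h" | "p = i" | "h < p" "p < i" using pq by force
      then show "(p, q) \<in> ?D'"
      proof cases
        case 1
        then show ?thesis using gap[of q] pq by (auto simp: mem_sweep)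
      next
        case 2
        then show ?thesis using f(8)[of q] pq b by (auto simp: mem_sweep)
      next
        case 3
        then show ?thesis using full[of p q] pq b by (auto simp: mem_sweep)
      qed
    qed (use f b less.prems in \<open>auto simp: mem_sweep\<close>)
    have eq: "sweep D h i j k = insert (h, b) (?D' - {(i, j)})"
    proof (rule pair_set_eqI)
      fix r c show "(r, c) \<in> sweep D h i j k \<longleftrightarrow> (r, c) \<in> insert (h, b) (?D' - {(i, j)})"
        using f(1-6) b gap[of c] by (cases "c < b"; cases "c = b"; cases "c = j") (auto simp: mem_sweep)
    qed
    have m: "move_op_dom (n, i, j, ?D')" "move_op n i j ?D' = sweep D h i j k"
      using move_op_ladder[OF r, of n] b less.prems(4) eq by auto
    have "move_op_dom (n, i, j, D)" "move_op n i j D = sweep D h i j k"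
      using move_op_col[OF less(2,5,3) b(1,3,2) gap IH(1)] IH(2) m by auto
    moreover have "ladder_step_NE i j ?D' (sweep D h i j k)"
      using r eq ladder_step_NE_iff by blast
    then have "(ladder_step_NE i j)\<^sup>+\<^sup>+ D (sweep D h i j k)"
      using NE_tranclp_mono[OF IH(3)] b by (meson less_imp_le order_refl tranclp.trancl_into_trancl)
    ultimately show ?thesis by blast
  qed
qed


section \<open>\<open>move_rel\<close> computes \<open>move_op\<close>: existence and uniqueness of
  runs\<close>

locale permutation_of =
  fixes n :: nat and w :: "nat \<Rightarrow> nat"
  assumes w_permutes: "w permutes {1..n}"
begin

text \<open>The cross at \<open>(i, k - 1)\<close> obeys \<open>RPD_bound\<close>, so the search for
  \<open>rect_k\<close> up to \<open>n\<close> reaches \<open>k\<close>.\<close>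

lemma frame_le:
  assumes "D \<in> RPD w" "frame D h i j k"
  shows "k \<le> n"
proof -
  note f = frameD[OF assms(2)]
  have "(i, k - 1) \<in> D" using f(8)[of "k - 1"] f(4) by simp
  then show ?thesis using RPD_bound[OF w_permutes assms(1)] f(2,4) by fastforce
qed

lemma frame_exists:
  assumes D: "D \<in> RPD w" and m: "movable i j D"
  obtains h k where "frame D h i j k"
proof -
  define h where "h = Max {h \<in> {1..<i}. (h, j) \<notin> D}"
  define k where "k = (LEAST k. j < k \<and> (i, k) \<notin> D)"
  have ij: "(i, j) \<in> D" and ne: "{h \<in> {1..<i}. (h, j) \<notin> D} \<noteq> {}"
    using m by (auto simp: movable_def)
  have fin: "finite {h \<in> {1..<i}. (h, j) \<notin> D}" by simp
  have h: "1 \<le> h" "h < i" "(h, j) \<notin> D" using Max_in[OF fin ne] by (auto simp: h_def)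
  have col: "(r, j) \<in> D" if "h < r" "r \<le> i" for r
    using Max_ge[OF fin, of r] that ij h(1) unfolding h_def[symmetric] by (cases "r = i") auto
  \<comment> \<open>By \<open>RPD_bound\<close> this column lies beyond all crosses, so row
    \<open>i\<close> has a bump right of \<open>j\<close>.\<close>
  have "\<not> (i, n + j + 1) \<in> D" using RPD_bound[OF w_permutes D, of i "n + j + 1"] by auto
  then have k: "j < k \<and> (i, k) \<notin> D"
    unfolding k_def by (intro LeastI[of "\<lambda>k. j < k \<and> (i, k) \<notin> D" "n + j + 1"]) simp
  have row: "(i, c) \<in> D" if "j \<le> c" "c < k" for c
    using not_less_Least[of c "\<lambda>k. j < k \<and> (i, k) \<notin> D"] that ij
    unfolding k_def[symmetric] by (cases "c = j") auto
  have "frame D h i j k"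
    unfolding frame_def using h k col row RPD_D(2)[OF D ij] by auto
  then show thesis by (rule that)
qed

lemma move_rel_move_op:
  assumes "move_rel D h i j k E" "D \<in> RPD w"
  shows "move_op_dom (n, i, j, D) \<and> move_op n i j D = E \<and> (ladder_step_NE i j)\<^sup>+\<^sup>+ D E"
  using assms
proof (induction rule: move_rel.induct)
  case (base i j k)
  then show ?case using move_op_sweep frame_le by blast
next
  case (row i j k a c E)
  have IH: "move_op_dom (n, a, j, D)" "move_op n a j D = E" "(ladder_step_NE a j)\<^sup>+\<^sup>+ D E"
    using row by auto
  have path: "(ladder_step_NE i j)\<^sup>+\<^sup>+ D E" using NE_tranclp_mono[OF IH(3)] row(3) by simp
  have E: "E \<in> RPD w" using RPD_NE_steps tranclp_into_rtranclp IH(3) row.prems by metis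
  \<comment> \<open>The inner run leaves a bump at \<open>(a, j)\<close>, so row \<open>a\<close> is
    the top of the next rectangle and the outer call is one sweep.\<close>
  have f: "frame E a i j k" using move_rel_frame_below row by blast
  have s: "move_op_dom (n, i, j, E)" "move_op n i j E = sweep E a i j k"
    "(ladder_step_NE i j)\<^sup>+\<^sup>+ E (sweep E a i j k)"
    using move_op_sweep[OF f _ row(7) frame_le[OF E f]] row(4) move_rel_full_rows_below[OF row(6)] by auto
  have ac: "(a, c) \<notin> D" "j < c" using frameD[OF move_rel_frame[OF row(6)]] by auto
  have "move_op_dom (n, i, j, D)" "move_op n i j D = sweep E a i j k"
    using move_op_row[OF row(1) frame_le[OF row.prems row(1)] row(2,3,4) _ row(5) ac(1) IH(1)]
      IH(2) s ac(2) by auto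
  then show ?case using path s(3) by auto
qed

text \<open>Both results are values of \<open>move_op\<close>, so derivations need not be
  compared.\<close>

lemma move_rel_det:
  assumes "move_rel D h i j k E" "move_rel D h' i j k' E'" "D \<in> RPD w"
  shows "E = E'"
  using move_rel_move_op[OF assms(1,3)] move_rel_move_op[OF assms(2,3)] by simp

lemma move_rel_RPD: "move_rel D h i j k E \<Longrightarrow> D \<in> RPD w \<Longrightarrow> E \<in> RPD w"
  using move_rel_move_op RPD_NE_steps tranclp_into_rtranclp by metis

text \<open>Induction on the bottom row, with \<open>a\<close> the lowest interior row containing a
  bump; \<open>RPD_full_corner\<close> supplies the corner bumps that the sweeps require.\<close>

lemma move_rel_exists_frame:
  assumes "D \<in> RPD w" "frame D h i j k"
  shows "\<exists>E. move_rel D h i j k E"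
  using assms(2)
proof (induction i arbitrary: k rule: less_induct)
  case (less i)
  note f = frameD[OF less.prems]
  let ?A = "{a \<in> {h<..<i}. \<exists>q\<in>{j..k}. (a, q) \<notin> D}"
  show ?case
  proof (cases "?A = {}")
    case True
    then have "full_rows D h i j k" unfolding full_rows_def by auto
    then show ?thesis using move_rel.base less.prems RPD_full_corner assms(1) by blast
  next
    case False
    define a where "a = Max ?A"
    have fin: "finite ?A" by simp
    obtain q where a: "h < a" "a < i" and q: "q \<in> {j..k}" "(a, q) \<notin> D"
      using Max_in[OF fin False] unfolding a_def[symmetric] by auto
    have full: "full_rows D a i j k" unfolding full_rows_def
    proof (intro allI impI)
      fix r c assume "a < r" "r < i" "j \<le> c" "c \<le> k"
      moreover from this have "r \<notin> ?A" using Max_ge[OF fin, of r] unfolding a_def[symmetric] by auto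
      ultimately show "(r, c) \<in> D" using a(1) by auto
    qed
    have "movable a j D" unfolding movable_def using f a by auto
    then obtain h' c where fr: "frame D h' a j c" using frame_exists assms(1) by blast
    \<comment> \<open>Column \<open>j\<close> has only crosses between \<open>h\<close> and
      \<open>a\<close>, so both rectangles have the same top row.\<close>
    have "h' = h"
    proof (rule ccontr)
      assume "h' \<noteq> h"
      then consider "h' < h" | "h < h'" by linarith
      then show False
        using f(5) f(7)[of h'] a frameD(2,5)[OF fr] frameD(7)[OF fr, of h] by cases auto
    qed
    have c: "c \<le> k"
      using frameD(8)[OF fr, of q] q by (metis atLeastAtMost_iff leI le_trans)
    obtain E where E: "move_rel D h a j c E" using less.IH[OF a(2)] fr \<open>h' = h\<close> by blast
    have fE: "frame E a i j k" by (rule move_rel_frame_below[OF E less.prems a(2)])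
    have "full_rows E a i j k" using full move_rel_full_rows_below[OF E] by simp
    then have "(a, k) \<notin> E" using RPD_full_corner[OF move_rel_RPD[OF E assms(1)] fE] by blast
    then show ?thesis using move_rel.row[OF less.prems a full c E] by blast
  qed
qed

lemma move_rel_exists:
  assumes "D \<in> RPD w" "movable i j D"
  obtains h k E where "move_rel D h i j k E"
  using frame_exists[OF assms] move_rel_exists_frame assms(1) by metis

section \<open>Monotonicity under northeast ladder moves\<close>

text \<open>The run of \<open>D1\<close> forces a cross at \<open>(i, j)\<close> in
  \<open>D1\<close>, which excludes the ladder move at \<open>(i, j)\<close> itself.\<close>

definition move_rel_monotone :: "(nat \<times> nat) set \<Rightarrow> bool" where
  "move_rel_monotone D \<longleftrightarrow> (\<forall>h i j k E D1 h1 k1 F. move_rel D h i j k E \<longrightarrow> ladder_step_NE i j D D1 \<longrightarrow>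
     move_rel D1 h1 i j k1 F \<longrightarrow> (ladder_step_NE i j)\<^sup>*\<^sup>* E F)"

text \<open>Row sums fall along the path, so monotonicity is assumed only up to \<open>m\<close>; in
  this form it can serve inside an induction on the row sum.\<close>

lemma move_rel_monotone_path:
  assumes mono: "\<And>D'. D' \<in> RPD w \<Longrightarrow> row_sum D' \<le> m \<Longrightarrow> move_rel_monotone D'"
    and path: "(ladder_step_NE i j)\<^sup>*\<^sup>* D D1"
    and "D \<in> RPD w" "row_sum D \<le> m" "move_rel D h i j k E" "move_rel D1 h1 i j k1 F"
  shows "(ladder_step_NE i j)\<^sup>*\<^sup>* E F"
  using path assms(3-)
proof (induction arbitrary: h k E rule: converse_rtranclp_induct)
  case base
  then show ?case using move_rel_det by blast
next
  case (step D D')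
  \<comment> \<open>Northeast moves never create a cross at \<open>(i, j)\<close>, so the one in
    \<open>D1\<close> is present along the whole path.\<close>
  have "(i, j) \<in> D1" using frameD(2,7)[OF move_rel_frame[OF step.prems(4)]] by simp
  then have ij: "(i, j) \<in> D'" using NE_steps_keep_bump step(2) by blast
  have "movable i j D" using movable_frame move_rel_frame step.prems by blast
  then have "movable i j D'" using NE_step_keeps_movable step(1) ij by blast
  moreover have D': "D' \<in> RPD w" "row_sum D' \<le> m"
    using step ladder_step_NE_imp_ladder_step RPD_ladder_step ladder_step_row_sum
    by (blast, metis less_imp_le order_trans)
  ultimately obtain h' k' E' where E': "move_rel D' h' i j k' E'" using move_rel_exists by blast
  have "(ladder_step_NE i j)\<^sup>*\<^sup>* E E'"
    using mono[OF step.prems(1,2)] step(1) step.prems(3) E' unfolding move_rel_monotone_def by blast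
  also have "(ladder_step_NE i j)\<^sup>*\<^sup>* E' F"
    using step.IH[OF D' E' step.prems(4)] .
  finally show ?case .
qed

text \<open>When the run is one sweep, the position of \<open>(p, q)\<close> relative to the frame
  decides whether \<open>F\<close> equals the sweep or is one ladder move above it.\<close>

lemma move_rel_monotone_base:
  assumes D: "D \<in> RPD w" and f: "frame D h i j k" and full: "full_rows D h i j k"
    and hk: "(h, k) \<notin> D"
    and r: "ladder_rect D p q h' k'" and pq: "p \<le> i" "j \<le> q" "(p, q) \<noteq> (i, j)"
    and D1: "D1 = insert (h', k') (D - {(p, q)})" and F: "move_rel D1 h1 i j k1 F"
  shows "(ladder_step_NE i j)\<^sup>*\<^sup>* (sweep D h i j k) F"
proof -
  let ?E = "sweep D h i j k"
  note fr = frameD[OF f] and fu = full_rowsD[OF full] and d = ladder_rectD[OF r]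
  have D1R: "D1 \<in> RPD w" using RPD_ladder_move[OF D r] D1 by simp
  have E: "move_rel D h i j k ?E" using move_rel.base f full hk .
  have step: "(ladder_step_NE i j)\<^sup>*\<^sup>* ?E F"
    if "ladder_rect ?E p' q' h'' k''" "p' \<le> i" "j \<le> q'" "F = insert (h'', k'') (?E - {(p', q')})"
    for p' q' h'' k''
  proof (rule r_into_rtranclp)
    show "ladder_step_NE i j ?E F" unfolding ladder_step_NE_iff using that by blast
  qed
  consider "p < h \<or> k < q" | "p = i" "q < k" | "h < p" "p < i" "q \<le> k" | "p = h" "q < k"
  proof -
    have "\<not> (p = i \<and> q = k)" "\<not> (p = h \<and> q = k)" using d(5) fr(6) hk by auto
    then show thesis using that pq(1) by linarith
  qed
  then show ?thesis
  proof cases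
    case 1
    \<comment> \<open>The two rectangles are disjoint, so the moves commute.\<close>
    have "ladder_rect ?E p q h' k'" "move_rel D1 h i j k (insert (h', k') (?E - {(p, q)}))"
      unfolding D1 by (rule move_rel_commute[OF E r]; use 1 d in auto)+
    then show ?thesis using step pq move_rel_det[OF F _ D1R] by blast
  next
    case 2
    \<comment> \<open>The ladder rectangle turns out to be \<open>[h,i] x [q,k]\<close>: the step is
      the first ladder move of the sweep, and \<open>F\<close> is the sweep itself.\<close>
    have "k' = k"
    proof (rule ccontr)
      assume "k' \<noteq> k"
      then consider "k' < k" | "k < k'" by linarith
      then show False using fr(6) fr(8)[of k'] d(2,4,7) d(9)[of i k] 2 pq by cases auto
    qed
    have "h' = h"
    proof (rule ccontr)
      assume "h' \<noteq> h"
      then consider "h' < h" | "h < h'" by linarith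
      then show False using fu[of h' q] d(2,4,6) d(9)[of h k] 2 pq hk \<open>k' = k\<close> fr(2) by cases auto
    qed
    have "j < q" using pq 2 by (auto simp: le_less)
    have gap: "(h, c) \<in> D" if "q < c" "c < k" for c
      using d(9)[of h c] that \<open>k' = k\<close> \<open>h' = h\<close> d(2) by auto
    have "frame D1 h i j q"
      unfolding frame_def D1 using fr \<open>j < q\<close> 2 \<open>k' = k\<close> \<open>h' = h\<close> by auto
    moreover have "full_rows D1 h i j q"
      unfolding full_rows_def D1 using fu 2 by auto
    moreover have "(h, q) \<notin> D1" using D1 d(6) 2 \<open>h' = h\<close> \<open>k' = k\<close> by simp
    ultimately have "move_rel D1 h i j q (sweep D1 h i j q)" by (rule move_rel.base)
    moreover have "sweep D1 h i j q = ?E"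
    proof (rule pair_set_eqI)
      fix r c show "(r, c) \<in> sweep D1 h i j q \<longleftrightarrow> (r, c) \<in> ?E"
        using gap[of c] d(6) 2 \<open>h' = h\<close> \<open>k' = k\<close> \<open>j < q\<close> fr(2,6) hk
        by (cases "c < q"; cases "c = q"; cases "c = k") (auto simp: mem_sweep D1)
    qed
    ultimately show ?thesis using move_rel_det[OF F _ D1R] by auto
  next
    case 3
    \<comment> \<open>As interior rows are full, the step takes \<open>(p, k)\<close> to
      \<open>(h, k')\<close> with \<open>k' > k\<close>. The run of \<open>D1\<close> must then pass
      through row \<open>p\<close>, and its result is one ladder move at \<open>(p, j)\<close>
      further.\<close>
    have "k < k'"
    proof (rule ccontr)
      assume "\<not> k < k'"
      then show False using fu[of p k'] 3 d(4,7) pq by simp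
    qed
    have "h' = h"
    proof (rule ccontr)
      assume "h' \<noteq> h"
      then consider "h' < h" | "h < h'" by linarith
      then show False using fu[of h' q] d(2,6) d(9)[of h k] 3 pq hk \<open>k < k'\<close> by cases auto
    qed
    have "q = k"
    proof (rule ccontr)
      assume "q \<noteq> k"
      then show False using d(2) d(9)[of h k] 3 hk \<open>k < k'\<close> \<open>h' = h\<close> by auto
    qed
    let ?D2 = "sweep D1 h p j k"
    have "frame D1 h p j k"
      unfolding frame_def D1 using fr fu 3 \<open>q = k\<close> \<open>h' = h\<close> \<open>k < k'\<close> by auto
    moreover have "full_rows D1 h p j k" unfolding full_rows_def D1 using fu 3 by auto
    moreover have "(h, k) \<notin> D1" using D1 hk \<open>k < k'\<close> by simp
    ultimately have D2: "move_rel D1 h p j k ?D2" by (rule move_rel.base)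
    have "frame D1 h i j k"
      unfolding frame_def D1 using fr 3 \<open>q = k\<close> \<open>h' = h\<close> \<open>k < k'\<close> by auto
    moreover have "full_rows D1 p i j k" unfolding full_rows_def D1 using fu 3 by auto
    moreover have "(p, k) \<notin> ?D2" using move_rel_corners[OF D2] by simp
    ultimately have "move_rel D1 h i j k (sweep ?D2 p i j k)"
      using D2 3 by (intro move_rel.row) auto
    then have Feq: "F = sweep ?D2 p i j k" using move_rel_det[OF F _ D1R] by simp
    have "F = insert (h, k') (?E - {(p, j)})" unfolding Feq
    proof (rule pair_set_eqI)
      fix r c
      show "(r, c) \<in> sweep ?D2 p i j k \<longleftrightarrow> (r, c) \<in> insert (h, k') (?E - {(p, j)})"
        using fr(1-6) 3 \<open>q = k\<close> \<open>h' = h\<close> \<open>k < k'\<close> hk fu[of p c]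
        by (cases "r = p"; cases "r = i"; cases "r = h"; cases "c = j"; cases "c \<le> k"; cases "j \<le> c")
          (auto simp: mem_sweep D1)
    qed
    moreover have "ladder_rect ?E p j h k'"
      unfolding ladder_rect_def
    proof (intro conjI ballI impI)
      fix r c assume rc: "r \<in> {h..p}" "c \<in> {j..k'}" "(r, c) \<notin> {(h, j), (p, k'), (h, k')}"
      show "(r, c) \<in> ?E"
      proof (cases "c \<le> k")
        case True
        then show ?thesis using rc 3 fu[of r c] by (cases "r = h") (auto simp: mem_sweep)
      next
        case False
        then show ?thesis
          using rc 3 d(9)[of r c] \<open>q = k\<close> \<open>h' = h\<close> by (cases "r = h") (auto simp: mem_sweep)
      qed
    qed (use fr(1-6) fu[of p j] 3 d(1-8) \<open>k < k'\<close> \<open>h' = h\<close> in \<open>auto simp: mem_sweep\<close>)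
    ultimately show ?thesis using step 3 by simp
  next
    case 4
    \<comment> \<open>The step opens a bump at \<open>(h, q)\<close>, which the sweep of
      \<open>D1\<close> carries down to \<open>(i, q)\<close>; the results differ by a ladder move
      from \<open>(i, q)\<close> to \<open>(h', k')\<close>.\<close>
    have "j < q" using pq d(5) fr(5) 4 by (metis le_neq_implies_less)
    have "k' \<le> k"
    proof (rule ccontr)
      assume "\<not> k' \<le> k"
      then show False using d(2) d(9)[of h k] 4 hk by simp
    qed
    have "frame D1 h i j k" unfolding frame_def D1 using fr 4 d(2) by auto
    moreover have "full_rows D1 h i j k" unfolding full_rows_def D1 using fu 4 by auto
    moreover have "(h, k) \<notin> D1" using D1 hk 4 d(2) by simp
    ultimately have "move_rel D1 h i j k (sweep D1 h i j k)" by (rule move_rel.base)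
    then have Feq: "F = sweep D1 h i j k" using move_rel_det[OF F _ D1R] by simp
    have "F = insert (h', k') (?E - {(i, q)})" unfolding Feq
    proof (rule pair_set_eqI)
      fix r c
      show "(r, c) \<in> sweep D1 h i j k \<longleftrightarrow> (r, c) \<in> insert (h', k') (?E - {(i, q)})"
        using fr(1-6) 4 d(2) \<open>j < q\<close> by (auto simp: mem_sweep D1)
    qed
    moreover have "ladder_rect ?E i q h' k'"
      unfolding ladder_rect_def
    proof (intro conjI ballI impI)
      fix r c assume rc: "r \<in> {h'..i}" "c \<in> {q..k'}" "(r, c) \<notin> {(h', q), (i, k'), (h', k')}"
      consider "r < h" | "r = h" | "h < r" "r < i" | "r = i" using rc by force
      then show "(r, c) \<in> ?E"
      proof cases
        case 1
        then show ?thesis using rc d(9)[of r c] 4 fr(2) by (auto simp: mem_sweep)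
      next
        case 2
        then show ?thesis using rc \<open>j < q\<close> \<open>k' \<le> k\<close> by (auto simp: mem_sweep)
      next
        case 3
        then show ?thesis using rc \<open>j < q\<close> \<open>k' \<le> k\<close> fu[of r c] by (auto simp: mem_sweep)
      next
        case 4
        then have c: "q \<le> c" "c < k'" using rc by auto
        then have "(h, c) \<in> D" using d(2) d(9)[of h c] \<open>p = h\<close> by auto
        then show ?thesis using 4 c fr(8)[of c] \<open>j < q\<close> \<open>k' \<le> k\<close> by (auto simp: mem_sweep)
      qed
    qed (use fr(1-6) fr(8)[of q] d(1-8) 4 \<open>j < q\<close> \<open>k' \<le> k\<close> in \<open>auto simp: mem_sweep\<close>)
    ultimately show ?thesis using step \<open>j < q\<close> by simp
  qed
qed

text \<open>Both runs are split at row \<open>a\<close>. The hypothesis \<open>IHa\<close> compares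
  the inner results, and \<open>IH\<close> applies to the outer calls because \<open>D2\<close> has
  a smaller row sum.\<close>

lemma move_rel_monotone_row:
  assumes IH: "\<And>D'. D' \<in> RPD w \<Longrightarrow> row_sum D' < row_sum D \<Longrightarrow> move_rel_monotone D'"
    and IHa: "\<And>E D1 h1 c1 F. move_rel D h a j c E \<Longrightarrow> ladder_step_NE a j D D1 \<Longrightarrow> move_rel D1 h1 a j c1 F \<Longrightarrow>
      (ladder_step_NE a j)\<^sup>*\<^sup>* E F"
    and D: "D \<in> RPD w" and f: "frame D h i j k"
    and a: "h < a" "a < i" "full_rows D a i j k" "c \<le> k"
    and D2: "move_rel D h a j c D2" and ak: "(a, k) \<notin> D2"
    and r: "ladder_rect D p q h' k'" and pq: "p \<le> i" "j \<le> q" "(p, q) \<noteq> (i, j)"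
    and D1: "D1 = insert (h', k') (D - {(p, q)})" and F: "move_rel D1 h1 i j k1 F"
  shows "(ladder_step_NE i j)\<^sup>*\<^sup>* (sweep D2 a i j k) F"
proof -
  note fr = frameD[OF f] and fu = full_rowsD[OF a(3)] and d = ladder_rectD[OF r]
  note fa = frameD[OF move_rel_frame[OF D2]]
  have D1R: "D1 \<in> RPD w" using RPD_ladder_move[OF D r] D1 by simp
  have D2R: "D2 \<in> RPD w" by (rule move_rel_RPD[OF D2 D])
  have smaller: "row_sum D2 < row_sum D" using NE_tranclp_row_sum move_rel_move_op[OF D2 D] D by blast
  have f2: "frame D2 a i j k" by (rule move_rel_frame_below[OF D2 f a(2)])
  have E: "move_rel D2 a i j k (sweep D2 a i j k)"
    using move_rel.base[OF f2] a(3) ak move_rel_full_rows_below[OF D2] by simp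
  note f1 = move_rel_frame[OF F]
  \<comment> \<open>Rows \<open>a\<close> to \<open>i\<close> have no bump left of column
    \<open>c\<close>, the condition under which \<open>move_rel_via_row\<close> may enter at row
    \<open>a\<close>.\<close>
  have left: "(r, x) \<in> D" if "a \<le> r" "r \<le> i" "j \<le> x" "x < c" for r x
    using that fa(8)[of x] fr(8)[of x] fu[of r x] a(4) by (cases "r = a"; cases "r = i") auto
  \<comment> \<open>It remains to find a run of \<open>D1\<close> at row \<open>a\<close> whose
    result is reachable from \<open>D2\<close>: by \<open>move_rel_via_row\<close>, \<open>F\<close>
    is the outer value at that result.\<close>
  have finish: "(ladder_step_NE i j)\<^sup>*\<^sup>* (sweep D2 a i j k) F"
    if D2': "move_rel D1 h2 a j c2 D2'" and path: "(ladder_step_NE i j)\<^sup>*\<^sup>* D2 D2'"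
      and left1: "\<And>r x. a < r \<Longrightarrow> r \<le> i \<Longrightarrow> j \<le> x \<Longrightarrow> x < c2 \<Longrightarrow> (r, x) \<in> D1" for h2 c2 D2'
  proof -
    have D2'R: "D2' \<in> RPD w" by (rule move_rel_RPD[OF D2' D1R])
    have "h2 = h1"
    proof (rule ccontr)
      assume "h2 \<noteq> h1"
      note f1' = frameD[OF f1] and f2'' = frameD[OF move_rel_frame[OF D2']]
      have "h1 \<le> a" using left1[of h1 j] f1'(2,5) f2''(4) by fastforce
      then show False
        using \<open>h2 \<noteq> h1\<close> f1'(5) f1'(7)[of h2] f2''(2,5) f2''(7)[of h1] a(2)
        by (cases "h2 < h1") auto
    qed
    then have "frame D2' a i j k1" using move_rel_frame_below[of D1 h1 a j c2 D2'] f1 D2' a(2) by simp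
    then obtain F' where F': "move_rel D2' a i j k1 F'" using move_rel_exists_frame D2'R by blast
    have "move_rel D1 h1 i j k1 F'"
      using move_rel_via_row[OF F' _ f1] D2' left1 \<open>h2 = h1\<close> by blast
    then have "F' = F" using move_rel_det F D1R by blast
    have "(ladder_step_NE i j)\<^sup>*\<^sup>* (sweep D2 a i j k) F'"
      by (rule move_rel_monotone_path[of "row_sum D2", OF _ path D2R _ E F'])
        (use IH smaller in auto)
    with \<open>F' = F\<close> show ?thesis by simp
  qed
  consider "(p, q) = (a, j)" | "p \<le> a" "(p, q) \<noteq> (a, j)" | "a < p" by linarith
  then show ?thesis
  proof cases
    case 1
    then have "move_rel D h' a j k' D1" using move_rel_ladder[of D a j h' k'] r D1 by simp
    then have "D2 = D1" using move_rel_det D2 D by blast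
    then show ?thesis using move_rel_det[OF _ F D1R] E by auto
  next
    case 2
    \<comment> \<open>A step starting in row \<open>a\<close> or above is northeast of
      \<open>(a, j)\<close>, so \<open>IHa\<close> applies; it fills no tile of row
      \<open>a\<close>, hence \<open>c2 <= c\<close>.\<close>
    have s: "ladder_step_NE a j D D1" unfolding ladder_step_NE_iff using 2 pq r D1 by blast
    have aj: "(a, j) \<in> D1" using 2 fa(2,7) D1 by auto
    have "movable a j D1"
      using NE_step_keeps_movable[OF s movable_frame[OF move_rel_frame[OF D2]] aj] .
    then obtain h2 c2 D2' where D2': "move_rel D1 h2 a j c2 D2'" using move_rel_exists D1R by blast
    have c2: "c2 \<le> c"
    proof (rule ccontr)
      assume "\<not> c2 \<le> c"
      then have "(a, c) \<in> D1" using frameD(8)[OF move_rel_frame[OF D2'], of c] fa(4) by simp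
      then show False using D1 fa(6) d(2) 2 by auto
    qed
    show ?thesis
    proof (rule finish[OF D2'])
      show "(ladder_step_NE i j)\<^sup>*\<^sup>* D2 D2'"
        using NE_rtranclp_mono[OF IHa[OF D2 s D2']] a(2) by simp
    next
      fix r x assume "a < r" "r \<le> i" "j \<le> x" "x < c2"
      then show "(r, x) \<in> D1" using left[of r x] c2 2 D1 by auto
    qed
  next
    case 3
    \<comment> \<open>A step from below row \<open>a\<close> stays weakly right of column
      \<open>c\<close>. Its rectangle meets the inner one at most in \<open>(a, c)\<close>, a bump
      in \<open>D\<close> and in \<open>D2\<close>, so it commutes with the inner run.\<close>
    have k': "c \<le> k'" using left[of p k'] d(4,7) 3 pq by fastforce
    have q: "c \<le> q"
    proof (rule ccontr)
      assume "\<not> c \<le> q"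
      show False
      proof (cases "a \<le> h'")
        case True
        then show ?thesis using left[of h' q] d(2,6) pq \<open>\<not> c \<le> q\<close> by auto
      next
        case False
        then show ?thesis using d(9)[of a c] fa(6) k' 3 \<open>\<not> c \<le> q\<close> by auto
      qed
    qed
    have h': "a \<le> h'" if "q = c"
      using d(9)[of a c] fa(6) that d(4) 3 by (cases "a \<le> h'") auto
    have agree: "(r, x) \<in> D2 \<longleftrightarrow> (r, x) \<in> D"
      if "h' \<le> r" "q \<le> x" "r \<le> a" "x \<le> c" for r x
    proof -
      have "x = c" "r = a" using that q h' by auto
      then show ?thesis using fa(6) move_rel_corners[OF D2] by simp
    qed
    have "ladder_rect D2 p q h' k'" "move_rel D1 h a j c (insert (h', k') (D2 - {(p, q)}))"
      unfolding D1 by (rule move_rel_commute[OF D2 r]; use 3 q d(4) agree in auto)+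
    moreover have "(ladder_step_NE i j)\<^sup>*\<^sup>* D2 (insert (h', k') (D2 - {(p, q)}))"
    proof (rule r_into_rtranclp)
      show "ladder_step_NE i j D2 (insert (h', k') (D2 - {(p, q)}))"
        unfolding ladder_step_NE_iff using calculation(1) pq by blast
    qed
    moreover have "(r, x) \<in> D1" if "a < r" "r \<le> i" "j \<le> x" "x < c" for r x
      using left[of r x] that q D1 by auto
    ultimately show ?thesis by (intro finish)
  qed
qed

text \<open>The outer induction on the row sum serves the pipe dream left after emptying a row; the
  inner one on \<open>i\<close> serves the run of the same \<open>D\<close> at a higher row.\<close>

lemma move_rel_monotone_RPD: "D \<in> RPD w \<Longrightarrow> move_rel_monotone D"
proof (induction "row_sum D" arbitrary: D rule: less_induct)
  case less
  have "(ladder_step_NE i j)\<^sup>*\<^sup>* E F"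
    if "move_rel D h i j k E" "ladder_step_NE i j D D1" "move_rel D1 h1 i j k1 F" for h i j k E D1 h1 k1 F
    using that
  proof (induction i arbitrary: k E D1 h1 k1 F rule: less_induct)
    case (less i)
    obtain p q h' k' where r: "p \<le> i" "j \<le> q" "ladder_rect D p q h' k'"
      and D1: "D1 = insert (h', k') (D - {(p, q)})"
      using less.prems(2) unfolding ladder_step_NE_iff by blast
    have "(i, j) \<in> D1" using frameD(2,7)[OF move_rel_frame[OF less.prems(3)]] by simp
    then have pq: "(p, q) \<noteq> (i, j)" using D1 ladder_rectD(2)[OF r(3)] by auto
    note D = \<open>D \<in> RPD w\<close>
    from less.prems(1) show ?case
    proof cases
      case base
      then show ?thesis using move_rel_monotone_base[OF D _ _ _ r(3,1,2) pq D1 less.prems(3)] by simp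
    next
      case (row a c E2)
      show ?thesis unfolding row(1)
        by (rule move_rel_monotone_row[OF _ less.IH[OF row(4)] D row(2-6,7,8) r(3,1,2) pq D1 less.prems(3)])
          (use less.hyps in auto)
    qed
  qed
  then show ?case unfolding move_rel_monotone_def by blast
qed

section \<open>The least element\<close>

lemma move_rel_le:
  assumes path: "(ladder_step_NE i j)\<^sup>*\<^sup>* D Q" and "move_rel D h i j k E" "D \<in> RPD w" "(i, j) \<notin> Q"
  shows "(ladder_step_NE i j)\<^sup>*\<^sup>* E Q"
  using assms
proof (induction arbitrary: h k E rule: converse_rtranclp_induct)
  case base
  then show ?case using frameD(2,7)[OF move_rel_frame[OF base(1)]] by simp
next
  case (step D D')
  have D': "D' \<in> RPD w"
    using RPD_ladder_step step.prems(2) ladder_step_NE_imp_ladder_step step.hyps(1) by blast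
  have m: "movable i j D" by (rule movable_frame[OF move_rel_frame[OF step.prems(1)]])
  show ?case
  proof (cases "(i, j) \<in> D'")
    case True
    then obtain h' k' E' where E': "move_rel D' h' i j k' E'"
      using move_rel_exists[OF D'] NE_step_keeps_movable[OF step.hyps(1) m] by blast
    have "(ladder_step_NE i j)\<^sup>*\<^sup>* E E'"
      using move_rel_monotone_RPD[OF step.prems(2)] step.hyps(1) step.prems(1) E'
      unfolding move_rel_monotone_def by blast
    also have "(ladder_step_NE i j)\<^sup>*\<^sup>* E' Q" by (rule step.IH[OF E' D' step.prems(3)])
    finally show ?thesis .
  next
    case False
    obtain p q h' k' where r: "ladder_rect D p q h' k'" and D'_eq: "D' = insert (h', k') (D - {(p, q)})"
      using step.hyps(1) unfolding ladder_step_NE_iff by blast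
    \<comment> \<open>The cross at \<open>(i, j)\<close> disappears in this step, so the step is the
      ladder move there and yields the value \<open>E\<close>.\<close>
    have "(p, q) = (i, j)" using False D'_eq m by (auto simp: movable_def)
    then have "E = D'" using move_rel_ladder[OF r] D'_eq move_rel_det step.prems(1,2) by blast
    then show ?thesis using step.hyps(2) by simp
  qed
qed

end

theorem proposition3p21:
  fixes n i j :: nat and w :: "nat \<Rightarrow> nat" and D :: "(nat \<times> nat) set"
  assumes "w permutes {1..n}"
    and "D \<in> RPD w"
    and "movable i j D"
  shows "RPD_minimal w (V_set w i j D) (move_op n i j D)
    \<and> (\<forall>Q. RPD_minimal w (V_set w i j D) Q \<longrightarrow> Q = move_op n i j D)"
proof -
  interpret permutation_of n w by standard fact
  let ?M = "move_op n i j D"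
  obtain h k where M: "move_rel D h i j k ?M"
    using move_rel_exists[OF assms(2,3)] move_rel_move_op[OF _ assms(2)] by metis
  have "(ladder_step_NE i j)\<^sup>*\<^sup>* D ?M"
    using move_rel_move_op[OF M assms(2)] by (simp add: tranclp_into_rtranclp)
  then have MV: "?M \<in> V_set w i j D"
    using move_rel_RPD[OF M assms(2)] move_rel_corners[OF M] by (simp add: V_set_def)
  have le: "RPD_le w ?M Q" if "Q \<in> V_set w i j D" for Q
    using that MV move_rel_le[OF _ M assms(2)] NE_rtranclp_imp_ladder_steps
    unfolding V_set_def RPD_le_def by blast
  \<comment> \<open>Along a nonempty path the row sum drops strictly, so paths in both directions
    must be empty.\<close>
  have antisym: "Q = Q'" if "RPD_le w Q Q'" "RPD_le w Q' Q" for Q Q'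
    using that ladder_steps_row_sum[of Q Q' w] ladder_steps_row_sum[of Q' Q w]
    unfolding RPD_le_def by auto
  \<comment> \<open>Antisymmetry makes the lower bound \<open>?M\<close> minimal; any other minimal
    element has \<open>?M\<close> below it and therefore equals it.\<close>
  show ?thesis
    using MV le antisym unfolding RPD_minimal_def by blast
qed

end
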